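(* Assume $\eta(\xi_0^{(0)}=0)=1$. For any $s\in(0,\infty)$, $Z_n(\bar\xi)h_n(\bar\xi,s)$ converges, as $n\to\infty$, with probability $1$ to a ($[0,\infty]$-valued) random variable $W(\bar\xi,s)$. If $\eta(D)>0$, where $D=\{\bar\xi: d(\bar\xi,s)=0\text{ for every } s\in(0,\infty)\}$, then for any $s\in(0,\infty)$, $$P_{\bar\xi}\big(W(\bar\xi,s)=\infty\big)>0\quad\text{and}\quad P_{\bar\xi}\big(W(\bar\xi,s)=0\big)>0\qquad\text{for }\eta\text{-a.e. }\bar\xi .$$
   Context: Setting. $\bar\xi=\{\xi_n:n\in\mathbb Z\}$ is an i.i.d. sequence of random probability distributions $\xi_n=\{\xi_n^{(0)},\xi_n^{(1)},\dots\}$ on the nonnegative integers; the law of the environment $\bar\xi$ is $\eta$. Given $\bar\xi$, $Z_0=1$ and $Z_n=Z_n(\bar\xi)$ is the sum of $Z_{n-1}$ independent random variables each with distribution $\xi_{n-1}$ (branching process in random environment). $P_{\bar\xi}$ is the (quenched) probability for fixed $\bar\xi$, and $\mathbb P(\cdot)=\int P_{\bar\xi}(\cdot)\,\eta(d\bar\xi)$; "with probability 1" refers to $\mathbb P$. The shift is $(\theta\bar\xi)_n=\xi_{n+1}$. Notation. $f_{\xi_i}(s)=\sum_{j\ge0}\xi_i^{(j)}s^j$ and $f_{\xi_i}^{(-1)}$ is its inverse function. For $0<s<\infty$, $h_{\xi_i}(s)=-\log f_{\xi_i}^{(-1)}(e^{-s})$ and $h_n(\bar\xi,s)=h_{\xi_{n-1}}(\cdots(h_{\xi_0}(s))\cdots)$,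 with $h_0(\bar\xi,s)=s$. Finally $d(\bar\xi,s)=\lim_{n\to\infty}\dfrac{h_{n+1}(\bar\xi,s)}{h_n(\theta\bar\xi,s)}$. *)

theory Defs
  imports "HOL-Probability.Probability"
begin

type_synonym environment = "int \<Rightarrow> nat pmf"
type_synonym offspring = "nat \<times> nat \<Rightarrow> nat"

text \<open>The sigma-algebra on probability distributions on the nonnegative integers is the one
  pulled back from the Giry monad; it is generated by the weights of the points.
  A random probability distribution has as its law a probability measure on these sets.\<close>

definition pmf_algebra :: "nat pmf measure" where
  "pmf_algebra = vimage_algebra UNIV measure_pmf (subprob_algebra (count_space UNIV))"

definition env_law :: "nat pmf measure \<Rightarrow> environment measure" where
  "env_law \<mu> = (\<Pi>\<^sub>M n\<in>(UNIV :: int set). \<mu>)"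

definition offspring_space :: "offspring measure" where
  "offspring_space = (\<Pi>\<^sub>M p\<in>(UNIV :: (nat \<times> nat) set). count_space (UNIV :: nat set))"

text \<open>The coordinate at \<open>(n, i)\<close> is the number of children of the individual with index \<open>i\<close> in
  generation \<open>n\<close>. Under the quenched law the coordinates are independent, and those of generation
  \<open>n\<close> are distributed according to \<open>\<xi> n\<close>.\<close>

definition quenched :: "environment \<Rightarrow> offspring measure" where
  "quenched \<xi> = (\<Pi>\<^sub>M p\<in>(UNIV :: (nat \<times> nat) set). measure_pmf (\<xi> (int (fst p))))"

definition annealed :: "nat pmf measure \<Rightarrow> (environment \<times> offspring) measure" where
  "annealed \<mu> =
     env_law \<mu> \<bind> (\<lambda>\<xi>. distr (quenched \<xi>) (env_law \<mu> \<Otimes>\<^sub>M offspring_space) (Pair \<xi>))"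

primrec Z :: "nat \<Rightarrow> offspring \<Rightarrow> nat" where
  "Z 0 \<omega> = 1"
| "Z (Suc n) \<omega> = (\<Sum>i<Z n \<omega>. \<omega> (n, i))"

definition pgf :: "nat pmf \<Rightarrow> real \<Rightarrow> real" where
  "pgf p s = (\<Sum>j. pmf p j * s ^ j)"

text \<open>If \<open>pmf p 0 = 0\<close>, then \<open>pgf p\<close> is a bijection of \<open>{0..1}\<close>, and the inverse is meant with
  respect to this interval.\<close>

definition pgf_inv :: "nat pmf \<Rightarrow> real \<Rightarrow> real" where
  "pgf_inv p = inv_into {0..1} (pgf p)"

definition h1 :: "nat pmf \<Rightarrow> real \<Rightarrow> real" where
  "h1 p s = - ln (pgf_inv p (exp (- s)))"

primrec h :: "nat \<Rightarrow> environment \<Rightarrow> real \<Rightarrow> real" where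
  "h 0 \<xi> s = s"
| "h (Suc n) \<xi> s = h1 (\<xi> (int n)) (h n \<xi> s)"

definition shift :: "environment \<Rightarrow> environment" where
  "shift \<xi> = (\<lambda>n. \<xi> (n + 1))"

text \<open>If \<open>pmf (\<xi> n) 0 = 0\<close> for all \<open>n \<ge> 0\<close>, then the functions \<open>h1 (\<xi> n)\<close> are convex on the positive
  half-line with limit \<open>0\<close> at \<open>0\<close>, and \<open>h1 (\<xi> n) s \<le> s\<close>. The quotients below are then nonincreasing
  in \<open>n\<close> for every \<open>s > 0\<close>, so the limit exists.\<close>

definition d :: "environment \<Rightarrow> real \<Rightarrow> real" where
  "d \<xi> s = lim (\<lambda>n. h (Suc n) \<xi> s / h n (shift \<xi>) s)"

text \<open>Measurability: for environments as above, the quotients are continuous in \<open>s\<close> and nonincreasing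
  in \<open>n\<close>, so Dini's theorem reduces the condition for all \<open>s > 0\<close> to countably many measurable ones.
  For the remaining environments the value of \<open>d\<close> is arbitrary. If these form a null set, then \<open>D\<close> is
  measurable for the completion of the law, and it is the completion that should measure it.\<close>

definition D :: "environment set" where
  "D = {\<xi>. \<forall>s>0. d \<xi> s = 0}"

lemma space_pmf_algebra [simp]: "space pmf_algebra = UNIV"
  by (simp add: pmf_algebra_def)

lemma measurable_measure_pmf_algebra:
  "measure_pmf \<in> measurable pmf_algebra (subprob_algebra (count_space UNIV))"
  unfolding pmf_algebra_def
  by (rule measurable_vimage_algebra1)
     (auto simp: space_subprob_algebra measure_pmf.subprob_space_axioms)

lemma prob_space_quenched: "prob_space (quenched \<xi>)"
  unfolding quenched_def by (intro prob_space_PiM measure_pmf.prob_space_axioms)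

lemma sets_quenched: "sets (quenched \<xi>) = sets offspring_space"
  unfolding quenched_def offspring_space_def by (intro sets_PiM_cong) auto

lemma sets_env_law: "sets \<mu> = sets pmf_algebra \<Longrightarrow> sets (env_law \<mu>) = sets (\<Pi>\<^sub>M n\<in>UNIV. pmf_algebra)"
  unfolding env_law_def by (intro sets_PiM_cong) auto

lemma measurable_quenched:
  assumes "sets \<mu> = sets pmf_algebra"
  shows "quenched \<in> measurable (env_law \<mu>) (prob_algebra offspring_space)"
proof -
  let ?C = "\<lambda>_::nat \<times> nat. count_space (UNIV :: nat set)"
  show ?thesis
  proof (rule measurable_prob_algebra_generated[where
          G = "prod_algebra UNIV ?C" and \<Omega> = "\<Pi>\<^sub>E p\<in>UNIV. space (?C p)"])
    show "sets offspring_space = sigma_sets (\<Pi>\<^sub>E p\<in>UNIV. space (?C p)) (prod_algebra UNIV ?C)"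
      unfolding offspring_space_def by (rule sets_PiM)
    show "Int_stable (prod_algebra UNIV ?C)" by (rule Int_stable_prod_algebra)
    show "prod_algebra UNIV ?C \<subseteq> Pow (\<Pi>\<^sub>E p\<in>UNIV. space (?C p))"
      by (rule prod_algebra_sets_into_space)
  next
    fix A assume "A \<in> prod_algebra UNIV ?C"
    then obtain J E where A: "A = prod_emb UNIV ?C J (Pi\<^sub>E J E)" "finite J"
      by (rule prod_algebraE) auto
    have emb: "emeasure (quenched \<xi>) A = (\<Prod>p\<in>J. emeasure (measure_pmf (\<xi> (int (fst p)))) (E p))" for \<xi>
    proof -
      interpret product_prob_space "\<lambda>p :: nat \<times> nat. measure_pmf (\<xi> (int (fst p)))" UNIV
        by unfold_locales
      have "A = prod_emb UNIV (\<lambda>p. measure_pmf (\<xi> (int (fst p)))) J (Pi\<^sub>E J E)"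
        using A by (simp add: prod_emb_def)
      then show ?thesis
        unfolding quenched_def using A(2) by (simp add: emeasure_PiM_emb)
    qed
    have m: "(\<lambda>\<xi>. emeasure (measure_pmf (\<xi> k)) B) \<in> borel_measurable (env_law \<mu>)" for k B
    proof -
      have "(\<lambda>\<xi> :: environment. \<xi> k) \<in> measurable (env_law \<mu>) pmf_algebra"
        unfolding env_law_def using measurable_component_singleton[of k UNIV "\<lambda>_. \<mu>"] assms
        by (simp cong: measurable_cong_sets)
      from measurable_compose[OF measurable_compose[OF this measurable_measure_pmf_algebra]
          measurable_emeasure_subprob_algebra[of B "count_space UNIV"]]
      show ?thesis by simp
    qed
    show "(\<lambda>\<xi>. emeasure (quenched \<xi>) A) \<in> borel_measurable (env_law \<mu>)"
      unfolding emb by (intro borel_measurable_prod_ennreal m)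
  qed (auto intro: prob_space_quenched simp: sets_quenched)
qed

lemma measurable_annealed_kernel:
  assumes "sets \<mu> = sets pmf_algebra"
  shows "(\<lambda>\<xi>. distr (quenched \<xi>) (env_law \<mu> \<Otimes>\<^sub>M offspring_space) (Pair \<xi>))
           \<in> measurable (env_law \<mu>) (prob_algebra (env_law \<mu> \<Otimes>\<^sub>M offspring_space))"
proof (rule measurable_distr_prob_space2)
  show "quenched \<in> measurable (env_law \<mu>) (prob_algebra offspring_space)"
    by (rule measurable_quenched[OF assms])
  show "(\<lambda>(\<xi>, \<omega>). (\<xi>, \<omega>)) \<in> measurable (env_law \<mu> \<Otimes>\<^sub>M offspring_space) (env_law \<mu> \<Otimes>\<^sub>M offspring_space)"
    unfolding case_prod_Pair by (rule measurable_ident)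
qed

text \<open>The annealed probability is the mixture of the quenched probabilities.\<close>

lemma emeasure_annealed:
  assumes "sets \<mu> = sets pmf_algebra" and "A \<in> sets (env_law \<mu> \<Otimes>\<^sub>M offspring_space)"
  shows "emeasure (annealed \<mu>) A = (\<integral>\<^sup>+\<xi>. emeasure (quenched \<xi>) {\<omega>. (\<xi>, \<omega>) \<in> A} \<partial>env_law \<mu>)"
proof -
  have "space (env_law \<mu>) \<noteq> {}"
    using sets_eq_imp_space_eq[OF assms(1)] by (simp add: env_law_def space_PiM)
  then have "emeasure (annealed \<mu>) A = 
      (\<integral>\<^sup>+\<xi>. emeasure (distr (quenched \<xi>) (env_law \<mu> \<Otimes>\<^sub>M offspring_space) (Pair \<xi>)) A \<partial>env_law \<mu>)"
    unfolding annealed_def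
    by (rule emeasure_bind[OF _ measurable_prob_algebraD[OF measurable_annealed_kernel[OF assms(1)]] assms(2)])
  also have "\<dots> = (\<integral>\<^sup>+\<xi>. emeasure (quenched \<xi>) {\<omega>. (\<xi>, \<omega>) \<in> A} \<partial>env_law \<mu>)"
  proof (rule nn_integral_cong)
    fix \<xi> assume x: "\<xi> \<in> space (env_law \<mu>)"
    have sp: "space (quenched \<xi>) = UNIV" by (simp add: quenched_def space_PiM)
    have "Pair \<xi> \<in> measurable (quenched \<xi>) (env_law \<mu> \<Otimes>\<^sub>M offspring_space)"
      using measurable_Pair1'[OF x, of offspring_space]
      by (simp cong: measurable_cong_sets add: sets_quenched)
    then show "emeasure (distr (quenched \<xi>) (env_law \<mu> \<Otimes>\<^sub>M offspring_space) (Pair \<xi>)) A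
        = emeasure (quenched \<xi>) {\<omega>. (\<xi>, \<omega>) \<in> A}"
      using assms(2) by (simp add: emeasure_distr vimage_def sp)
  qed
  finally show ?thesis .
qed

end

theory Submission
  imports Defs
begin

text \<open>
  Under the quenched law, \<open>exp (- h n \<xi> s) ^ Z n\<close> is a martingale with values in \<open>{0..1}\<close>, by the
  choice of \<open>h\<close>. Its almost sure limit \<open>X\<close> gives \<open>W = - ln X\<close>, and the expectation of \<open>X powr r\<close>,
  that is, the Laplace transform \<open>\<phi>(\<xi>, s, r)\<close> of \<open>W\<close>, is the limit of the iterated generating
  functions at \<open>exp (- r * h n \<xi> s)\<close>. Hence \<open>\<phi>(\<xi>, s, 1) = exp (- s)\<close>, and with the generating function
  \<open>f\<close> of \<open>\<xi> 0\<close> one has \<open>\<phi>(\<xi>, s, r) = f(\<phi>(shift \<xi>, h1 (\<xi> 0) s, r))\<close>. If \<open>d \<xi> s = 0\<close>, then moreover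
  \<open>\<phi>(\<xi>, s, r) \<ge> f(\<phi>(shift \<xi>, s, e))\<close> for all positive \<open>r\<close> and \<open>e\<close>. For \<open>e = 1\<close> this bounds
  \<open>\<phi>(\<xi>, s, \<cdot>)\<close> away from \<open>0\<close>, so that \<open>W = 0\<close> has positive probability; for \<open>r = 1\<close> it bounds
  \<open>\<phi>(shift \<xi>, s, \<cdot>)\<close> away from \<open>1\<close>, so that \<open>W = \<infinity>\<close> has positive probability. Both properties pass
  from \<open>shift \<xi>\<close> to \<open>\<xi>\<close>, and almost every environment is shifted into \<open>D\<close> at some time by
  Kolmogorov's zero-one law.\<close>

subsection \<open>Generating functions\<close>

lemma pgf_eq_expectation:
  assumes "0 \<le> s" "s \<le> 1"
  shows "pgf p s = measure_pmf.expectation p (\<lambda>j. s ^ j)"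
proof -
  have s: "norm (s ^ j) \<le> 1" for j
    using assms by (simp add: power_le_one)
  have "integrable (measure_pmf p) (\<lambda>j. s ^ j)"
    by (rule measure_pmf.integrable_const_bound[of _ 1]) (use s in auto)
  then have "integrable (count_space UNIV) (\<lambda>j. pmf p j * s ^ j)"
    unfolding measure_pmf_eq_density by (subst (asm) integrable_density) auto
  moreover have "measure_pmf.expectation p (\<lambda>j. s ^ j) = (LINT j|count_space UNIV. pmf p j * s ^ j)"
    unfolding measure_pmf_eq_density by (subst integral_density) auto
  ultimately show ?thesis
    unfolding pgf_def by (simp add: integral_count_space_nat)
qed

lemma integrable_power_pmf [simp]:
  fixes s :: real
  assumes "0 \<le> s" "s \<le> 1"
  shows "integrable (measure_pmf p) (\<lambda>j. s ^ j)"
  by (rule measure_pmf.integrable_const_bound[of _ 1]) (use assms in \<open>auto simp: power_le_one\<close>)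

lemma pgf_0 [simp]: "pgf p 0 = pmf p 0"
  unfolding pgf_def by (subst suminf_finite[of "{0}"]) auto

lemma pgf_1 [simp]: "pgf p 1 = 1"
  by (simp add: pgf_eq_expectation)

lemma pgf_nonneg: "0 \<le> s \<Longrightarrow> s \<le> 1 \<Longrightarrow> 0 \<le> pgf p s"
  by (simp add: pgf_eq_expectation)

lemma pgf_mono: "0 \<le> s \<Longrightarrow> s \<le> t \<Longrightarrow> t \<le> 1 \<Longrightarrow> pgf p s \<le> pgf p t"
  by (simp add: pgf_eq_expectation) (intro integral_mono, auto intro: power_mono)

lemma pgf_le_1: "0 \<le> s \<Longrightarrow> s \<le> 1 \<Longrightarrow> pgf p s \<le> 1"
  using pgf_mono[of s 1 p] by simp

lemma AE_pmf_pos: "pmf p 0 = 0 \<Longrightarrow> AE j in measure_pmf p. 0 < (j::nat)"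
  by (auto simp: AE_measure_pmf_iff set_pmf_iff) (metis gr0I)

lemma pgf_le_arg:
  assumes "pmf p 0 = 0" "0 \<le> s" "s \<le> 1"
  shows "pgf p s \<le> s"
proof -
  have "measure_pmf.expectation p (\<lambda>j. s ^ j) \<le> measure_pmf.expectation p (\<lambda>_. s)"
  proof (rule integral_mono_AE)
    show "AE j in measure_pmf p. s ^ j \<le> s"
      using AE_pmf_pos[OF assms(1)]
    proof eventually_elim
      case (elim j)
      then show ?case using power_decreasing[of 1 j s] assms by simp
    qed
  qed (use assms in auto)
  then show ?thesis using assms by (simp add: pgf_eq_expectation)
qed

lemma pgf_strict_mono:
  assumes "pmf p 0 = 0" "0 \<le> s" "s < t" "t \<le> 1"
  shows "pgf p s < pgf p t"
proof -
  have pos: "AE j in measure_pmf p. s ^ j < t ^ j"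
    using AE_pmf_pos[OF assms(1)]
    by eventually_elim (use assms in \<open>auto intro: power_strict_mono\<close>)
  have "measure_pmf.expectation p (\<lambda>j. s ^ j) < measure_pmf.expectation p (\<lambda>j. t ^ j)"
    by (rule measure_pmf.integral_less_AE_space[OF _ _ pos]) (use assms in auto)
  then show ?thesis
    using assms by (simp add: pgf_eq_expectation)
qed

lemma pgf_pos:
  assumes "0 < s" "s \<le> 1"
  shows "0 < pgf p s"
proof -
  have "measure_pmf.expectation p (\<lambda>j. 0) < measure_pmf.expectation p (\<lambda>j. s ^ j)"
    by (rule measure_pmf.integral_less_AE_space) (use assms in auto)
  then show ?thesis
    using assms by (simp add: pgf_eq_expectation)
qed

lemma continuous_on_pgf: "continuous_on {0..1} (pgf p)"
proof -
  have int: "integrable (count_space UNIV) (pmf p)"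
    by (rule integrable_pmf)
  then have "summable (pmf p)"
    by (simp add: integrable_count_space_nat_iff)
  then have "uniform_limit {0..1} (\<lambda>n s. \<Sum>j<n. pmf p j * s ^ j) (pgf p) sequentially"
    unfolding pgf_def[abs_def]
    by (rule Weierstrass_m_test[rotated])
       (auto simp: abs_mult power_le_one mult_left_le)
  then show ?thesis
    by (rule uniform_limit_theorem[rotated]) (auto intro!: always_eventually continuous_intros)
qed

lemma tendsto_pgf:
  assumes "f \<longlonglongrightarrow> l" "\<And>n. f n \<in> {0..1}"
  shows "(\<lambda>n. pgf p (f n)) \<longlonglongrightarrow> pgf p l"
proof -
  have "l \<in> {0..1}"
    using assms(2) by (intro closed_sequentially[OF _ _ assms(1)]) auto
  then show ?thesis
    using continuous_on_tendsto_compose[OF continuous_on_pgf assms(1)] assms(2) by auto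
qed

lemma pgf_inv:
  assumes "pmf p 0 = 0" "0 \<le> y" "y \<le> 1"
  shows pgf_inv_in: "pgf_inv p y \<in> {0..1}" and pgf_pgf_inv: "pgf p (pgf_inv p y) = y"
proof -
  obtain x where "0 \<le> x" "x \<le> 1" "pgf p x = y"
    using IVT'[of "pgf p" 0 y 1] continuous_on_pgf assms by auto
  then have "y \<in> pgf p ` {0..1}" by auto
  then show "pgf_inv p y \<in> {0..1}" "pgf p (pgf_inv p y) = y"
    unfolding pgf_inv_def by (rule inv_into_into, rule f_inv_into_f)
qed

lemma pgf_le_cancel:
  assumes "pmf p 0 = 0" "x \<in> {0..1}" "y \<in> {0..1}"
  shows "pgf p x \<le> pgf p y \<longleftrightarrow> x \<le> y"
  using assms pgf_strict_mono[of p y x] pgf_mono[of x y p] by (cases "x \<le> y") auto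

text \<open>Jensen's inequality for \<open>x powr r\<close>. It makes \<open>h1 p\<close> star-shaped, which is the only part of
  its convexity that is needed.\<close>

lemma pgf_exp_le_powr:
  assumes "0 \<le> a" "0 < r" "r \<le> 1"
  shows "pgf p (exp (- (r * a))) \<le> pgf p (exp (- a)) powr r"
proof -
  define m where "m = pgf p (exp (- a))"
  have m: "m > 0" unfolding m_def using assms by (intro pgf_pos) auto
  \<comment> \<open>The inequality
    \<open>x powr r * m powr (1 - r) \<le> r * x + (1 - r) * m\<close> is integrated with
    \<open>m\<close> the mean of \<open>x\<close>. The right side becomes
    \<open>m = m powr r * m powr (1 - r)\<close>, and the positive factor
    \<open>m powr (1 - r)\<close> cancels.\<close>
  have "pgf p (exp (- (r * a))) * m powr (1 - r) =
      measure_pmf.expectation p (\<lambda>j. exp (- (r * a)) ^ j * m powr (1 - r))"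
    using assms by (subst pgf_eq_expectation) auto
  also have "\<dots> \<le> measure_pmf.expectation p (\<lambda>j. r * exp (- a) ^ j + (1 - r) * m)"
  proof (rule integral_mono)
    fix j
    have "exp (- (r * a)) ^ j = (exp (- a) ^ j) powr r"
      by (simp add: powr_def ln_realpow flip: exp_of_nat_mult)
    then show "exp (- (r * a)) ^ j * m powr (1 - r) \<le> r * exp (- a) ^ j + (1 - r) * m"
      using Youngs_inequality_0[of r "1 - r" "exp (- a) ^ j" m] assms m by simp
  qed (use assms in auto)
  also have "\<dots> = r * m + (1 - r) * m"
    using assms by (simp add: m_def pgf_eq_expectation)
  also have "\<dots> = m powr r * m powr (1 - r)"
    using m by (simp add: algebra_simps flip: powr_add)
  finally show ?thesis using m unfolding m_def by simp
qed

lemma h1: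
  assumes "pmf p 0 = 0" "0 < s"
  shows h1_pos: "0 < h1 p s" and pgf_exp_h1: "pgf p (exp (- h1 p s)) = exp (- s)"
proof -
  let ?x = "pgf_inv p (exp (- s))"
  have x: "?x \<in> {0..1}" "pgf p ?x = exp (- s)"
    using pgf_inv[of p "exp (- s)"] assms by auto
  have "?x \<noteq> 0" "?x \<noteq> 1"
    using x(2) assms by auto
  then have "0 < ?x" "?x < 1" using x(1) by auto
  then show "0 < h1 p s" "pgf p (exp (- h1 p s)) = exp (- s)"
    using x(2) by (simp_all add: h1_def)
qed

lemma h1_le:
  assumes "pmf p 0 = 0" "0 < s"
  shows "h1 p s \<le> s"
  using pgf_le_arg[of p "exp (- h1 p s)"] h1[OF assms] assms by simp

text \<open>\<open>pgf p\<close> is strictly increasing, so the two sides may be compared after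
  \<open>exp (- _)\<close> and \<open>pgf p\<close> are applied, where the claim becomes Jensen's
  inequality. It makes the quotients in \<open>d\<close> monotone.\<close>

lemma h1_scale_le:
  assumes "pmf p 0 = 0" "0 < s" "0 < r" "r \<le> 1"
  shows "h1 p (r * s) \<le> r * h1 p s"
proof -
  have "pgf p (exp (- (r * h1 p s))) \<le> exp (- s) powr r"
    using pgf_exp_le_powr[of "h1 p s" r p] h1[of p s] assms by simp
  also have "\<dots> = pgf p (exp (- h1 p (r * s)))"
    using h1[of p "r * s"] assms by (simp add: powr_def)
  finally have "exp (- (r * h1 p s)) \<le> exp (- h1 p (r * s))"
    using assms h1[of p s] h1[of p "r * s"] by (subst (asm) pgf_le_cancel) auto
  then show ?thesis by simp
qed

section \<open>Iterates of \<open>h1\<close> and the limit \<open>d\<close>\<close>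

definition no_death :: "environment set" where
  "no_death = {\<xi>. \<forall>n::nat. pmf (\<xi> (int n)) 0 = 0}"

lemma no_deathD: "\<xi> \<in> no_death \<Longrightarrow> pmf (\<xi> (int n)) 0 = 0"
  by (simp add: no_death_def)

lemma no_deathD0: "\<xi> \<in> no_death \<Longrightarrow> pmf (\<xi> 0) 0 = 0"
  using no_deathD[of \<xi> 0] by simp

lemma shift_in_no_death: "\<xi> \<in> no_death \<Longrightarrow> shift \<xi> \<in> no_death"
  by (auto simp: no_death_def shift_def dest: spec[of _ "Suc _"] simp: add.commute)

lemma h_pos: "\<xi> \<in> no_death \<Longrightarrow> 0 < s \<Longrightarrow> 0 < h n \<xi> s"
  by (induction n) (auto intro: h1_pos no_deathD)

text \<open>The recursion appends the last generation, whereas this splits off the first. It turns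
  the quotient in \<open>d\<close> into a quotient of the same iterates at two starting
  points.\<close>

lemma h_Suc_shift: "h (Suc n) \<xi> s = h n (shift \<xi>) (h1 (\<xi> 0) s)"
proof (induction n)
  case (Suc n)
  have "h (Suc (Suc n)) \<xi> s = h1 (\<xi> (int (Suc n))) (h (Suc n) \<xi> s)" by simp
  also have "\<xi> (int (Suc n)) = shift \<xi> (int n)" by (simp add: shift_def add.commute)
  finally show ?case using Suc by simp
qed simp

text \<open>With \<open>t = h1 (\<xi> 0) s \<le> s\<close>, the quotient compares the iterates
  started at \<open>t\<close> and at \<open>s\<close>. It is at most \<open>1\<close> initially, and
  \<open>h1_scale_le\<close>, with the quotient itself as the factor, keeps it from increasing.
  Hence the \<open>lim\<close> in \<open>d\<close> is a genuine limit.\<close>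

lemma h_ratio_tendsto_d:
  assumes \<xi>: "\<xi> \<in> no_death" and s: "0 < s"
  shows "(\<lambda>n. h (Suc n) \<xi> s / h n (shift \<xi>) s) \<longlonglongrightarrow> d \<xi> s"
proof -
  let ?t = "h1 (\<xi> 0) s"
  let ?R = "\<lambda>n. h n (shift \<xi>) ?t / h n (shift \<xi>) s"
  have t: "0 < ?t" "?t \<le> s"
    using h1_pos h1_le no_deathD0[OF \<xi>] s by auto
  note \<xi>' = shift_in_no_death[OF \<xi>]
  have pos: "0 < h n (shift \<xi>) ?t" "0 < h n (shift \<xi>) s" for n
    using h_pos[OF \<xi>'] t s by auto
  have step: "?R (Suc n) \<le> ?R n" if "?R n \<le> 1" for n
  proof -
    have "h1 (shift \<xi> (int n)) (?R n * h n (shift \<xi>) s) \<le> ?R n * h1 (shift \<xi> (int n)) (h n (shift \<xi>) s)"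
      using that pos[of n] no_deathD[OF \<xi>'] by (intro h1_scale_le) auto
    moreover have "?R n * h n (shift \<xi>) s = h n (shift \<xi>) ?t"
      using pos[of n] by simp
    ultimately show ?thesis
      using pos[of "Suc n"] by (simp add: divide_le_eq)
  qed
  have le1: "?R n \<le> 1" for n
  proof (induction n)
    case 0 then show ?case using t s by simp
  next
    case (Suc n) then show ?case using step by force
  qed
  have "decseq ?R"
    using step le1 by (intro decseq_SucI) auto
  moreover have "0 \<le> ?R n" for n
    using pos[of n] by simp
  ultimately have "convergent ?R"
    by (intro Bseq_monoseq_convergent decseq_bounded[where B = 0] decseq_imp_monoseq) auto
  then show ?thesis
    unfolding d_def h_Suc_shift by (simp add: convergent_LIMSEQ_iff)
qed

subsection \<open>Convergence of bounded martingales\<close>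

text \<open>The martingale property \<open>step\<close> is stated through integrals against bounded
  multipliers known at time \<open>n\<close>, in place of conditional expectations. This is the form
  in which the branching property is proved and indicators of stopping events are used.\<close>

locale bounded_martingale = prob_space +
  fixes F :: "nat \<Rightarrow> 'a measure" and X :: "nat \<Rightarrow> 'a \<Rightarrow> real" and B :: real
  assumes subalg: "\<And>n. subalgebra M (F n)"
    and filtration: "\<And>m n. m \<le> n \<Longrightarrow> sets (F m) \<subseteq> sets (F n)"
    and adapted: "\<And>n. X n \<in> borel_measurable (F n)"
    and bounded: "\<And>n x. \<bar>X n x\<bar> \<le> B"
    and step: "\<And>n Y C. Y \<in> borel_measurable (F n) \<Longrightarrow> (\<And>x. \<bar>Y x\<bar> \<le> C) \<Longrightarrow>
      (\<integral>x. Y x * X (Suc n) x \<partial>M) = (\<integral>x. Y x * X n x \<partial>M)"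
begin

lemma measurable_F_mono: "m \<le> n \<Longrightarrow> f \<in> borel_measurable (F m) \<Longrightarrow> f \<in> borel_measurable (F n)"
  using subalg filtration
  by (auto simp: subalgebra_def intro!: measurable_from_subalg[of "F n" "F m"])

lemma borel_measurable_F: "f \<in> borel_measurable (F n) \<Longrightarrow> f \<in> borel_measurable M"
  by (rule measurable_from_subalg[OF subalg])

lemma X_measurable [measurable]: "X n \<in> borel_measurable M"
  by (rule borel_measurable_F[OF adapted])

lemma integral_multiplier:
  assumes "n \<le> m" "Y \<in> borel_measurable (F n)" "\<And>x. \<bar>Y x\<bar> \<le> C"
  shows "(\<integral>x. Y x * X m x \<partial>M) = (\<integral>x. Y x * X n x \<partial>M)"
  using assms(1)
proof (induction m rule: dec_induct)
  case (step k)
  then show ?case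
    using bounded_martingale_axioms assms(3) measurable_F_mono[OF _ assms(2)]
    by (subst bounded_martingale.step[of M F X B]) auto
qed simp

lemma integrable_bounded:
  assumes "f \<in> borel_measurable M" "\<And>x. \<bar>f x\<bar> \<le> (C::real)"
  shows "integrable M f"
  by (rule integrable_const_bound[of _ C]) (use assms in auto)

lemma X_diff_bound: "\<bar>X m x - X n x\<bar> \<le> 2 * B"
  using bounded[of m x] bounded[of n x] by linarith

lemma X_diff_square_bound: "(X m x - X n x)\<^sup>2 \<le> (2 * B)\<^sup>2"
  using power_mono[OF X_diff_bound[of m x n] abs_ge_zero, of 2] by simp

text \<open>Orthogonality of increments: write \<open>X m - X n\<close> as
  \<open>(X k - X n) + (X m - X k)\<close>. The cross term has the multiplier
  \<open>2 * Y * (X k - X n)\<close>, bounded and measurable at time \<open>k\<close>, so it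
  integrates to \<open>0\<close>, and the last square is dropped. In the application
  \<open>Y\<close> is the indicator of an event known at time \<open>k\<close>.\<close>

lemma integral_square_diff:
  assumes "n \<le> k" "k \<le> m" and Y: "Y \<in> borel_measurable (F k)" "\<And>x. Y x \<in> {0..1}"
  shows "(\<integral>x. Y x * (X k x - X n x)\<^sup>2 \<partial>M) \<le> (\<integral>x. Y x * (X m x - X n x)\<^sup>2 \<partial>M)"
proof -
  have [measurable]: "Y \<in> borel_measurable M"
    by (rule borel_measurable_F[OF Y(1)])
  have X: "X k \<in> borel_measurable (F k)" "X n \<in> borel_measurable (F k)"
    using adapted measurable_F_mono[OF assms(1)] by auto
  let ?V = "\<lambda>x. 2 * Y x * (X k x - X n x)"
  have Vb: "\<bar>?V x\<bar> \<le> 4 * B" for x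
  proof -
    have "\<bar>Y x\<bar> * \<bar>X k x - X n x\<bar> \<le> 1 * (2 * B)"
      using Y(2)[of x] X_diff_bound[of k x n] by (intro mult_mono) auto
    then show ?thesis by (simp add: abs_mult)
  qed
  have Vm: "?V \<in> borel_measurable (F k)"
    using X Y(1) by measurable
  have VXb: "\<bar>?V x * X j x\<bar> \<le> 4 * B * B" for x j
    unfolding abs_mult[of "?V x"] using Vb[of x] bounded[of j x] by (intro mult_mono) auto
  have int: "integrable M (\<lambda>x. ?V x * X j x)" for j
    by (rule integrable_bounded[OF _ VXb]) measurable
  have sqb: "\<bar>Y x * (X i x - X j x)\<^sup>2\<bar> \<le> 1 * (2 * B)\<^sup>2" for x i j
    unfolding abs_mult using Y(2)[of x] X_diff_square_bound[of i x j]
    by (intro mult_mono) auto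
  have sqi: "integrable M (\<lambda>x. Y x * (X i x - X j x)\<^sup>2)" for i j
    by (rule integrable_bounded[OF _ sqb]) measurable
  have zero: "(\<integral>x. ?V x * X m x - ?V x * X k x \<partial>M) = 0"
    using integral_multiplier[OF assms(2) Vm Vb] by (subst Bochner_Integration.integral_diff[OF int int]) simp
  have "(\<integral>x. Y x * (X k x - X n x)\<^sup>2 \<partial>M) =
      (\<integral>x. Y x * (X k x - X n x)\<^sup>2 + (?V x * X m x - ?V x * X k x) \<partial>M)"
    by (subst Bochner_Integration.integral_add) (use int sqi zero in auto)
  also have "\<dots> \<le> (\<integral>x. Y x * (X m x - X n x)\<^sup>2 \<partial>M)"
  proof (rule integral_mono)
    fix x
    have "Y x * (X m x - X n x)\<^sup>2 = Y x * (X k x - X n x)\<^sup>2 + (?V x * X m x - ?V x * X k x)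
        + Y x * (X m x - X k x)\<^sup>2"
      by (simp add: power2_eq_square algebra_simps)
    then show "Y x * (X k x - X n x)\<^sup>2 + (?V x * X m x - ?V x * X k x) \<le> Y x * (X m x - X n x)\<^sup>2"
      using Y(2)[of x] by simp
  qed (use int sqi in auto)
  finally show ?thesis .
qed

definition second_moment :: "nat \<Rightarrow> real" where
  "second_moment n = (\<integral>x. (X n x)\<^sup>2 \<partial>M)"

lemma square_bound: "\<bar>(X n x)\<^sup>2\<bar> \<le> B\<^sup>2"
  using power_mono[OF bounded[of n x] abs_ge_zero, of 2] by simp

text \<open>With \<open>X n\<close> itself as the multiplier, the integral of
  \<open>X n * X m\<close> equals \<open>second_moment n\<close>; this is Pythagoras'
  identity.\<close>

lemma integral_increment:
  assumes "n \<le> m"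
  shows "(\<integral>x. (X m x - X n x)\<^sup>2 \<partial>M) = second_moment m - second_moment n"
proof -
  have sq: "integrable M (\<lambda>x. (X j x)\<^sup>2)" for j
    by (rule integrable_bounded[OF _ square_bound]) measurable
  have "\<bar>X n x * X j x\<bar> \<le> B * B" for j x
    unfolding abs_mult using bounded[of j x] bounded[of n x] by (intro mult_mono) auto
  then have int: "integrable M (\<lambda>x. X n x * X j x)" for j
    by (intro integrable_bounded) auto
  have "(\<integral>x. (X m x - X n x)\<^sup>2 \<partial>M) = (\<integral>x. (X m x)\<^sup>2 + (X n x)\<^sup>2 - 2 * (X n x * X m x) \<partial>M)"
    by (intro Bochner_Integration.integral_cong) (auto simp: power2_eq_square algebra_simps)
  also have "\<dots> = second_moment m + second_moment n - 2 * (\<integral>x. X n x * X m x \<partial>M)"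
    unfolding second_moment_def using sq int by simp
  also have "(\<integral>x. X n x * X m x \<partial>M) = second_moment n"
    using integral_multiplier[OF assms adapted bounded] by (simp add: second_moment_def power2_eq_square)
  finally show ?thesis by simp
qed

text \<open>Kolmogorov's maximal inequality. The event is split by the first time \<open>k\<close>
  at which the deviation from \<open>X n\<close> reaches \<open>e\<close>; this part
  \<open>A k\<close> is known at time \<open>k\<close>, so its indicator can serve as
  \<open>Y\<close> in \<open>integral_square_diff\<close>, which carries the lower bound
  \<open>e\<^sup>2\<close> from time \<open>k\<close> to time \<open>m\<close>.\<close>

lemma maximal_inequality:
  assumes "n \<le> m" "0 < e"
  shows "e\<^sup>2 * prob {x \<in> space M. \<exists>k\<in>{n..m}. e \<le> \<bar>X k x - X n x\<bar>} \<le> second_moment m - second_moment n"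
proof -
  define A where "A k = {x \<in> space M. e \<le> \<bar>X k x - X n x\<bar> \<and> (\<forall>j\<in>{n..<k}. \<bar>X j x - X n x\<bar> < e)}" for k
  have space: "space (F k) = space M" for k
    using subalg by (auto simp: subalgebra_def)
  have AF: "A k \<in> sets (F k)" if "n \<le> k" for k
  proof -
    have [measurable]: "X j \<in> borel_measurable (F k)" if "j \<in> {n..<k}" for j
      using adapted measurable_F_mono[of j k] that by auto
    have [measurable]: "X k \<in> borel_measurable (F k)" "X n \<in> borel_measurable (F k)"
      using adapted measurable_F_mono[OF that] by auto
    show ?thesis
      unfolding A_def space[of k, symmetric] by measurable
  qed
  have AM [measurable]: "A k \<in> sets M" if "n \<le> k" for k
    using AF[OF that] subalg by (auto simp: subalgebra_def)
  have int: "integrable M (\<lambda>x. indicator (A k) x * (X m x - X n x)\<^sup>2)" if "k \<in> {n..m}" for k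
    using X_diff_square_bound[of m _ n] AM that
    by (intro integrable_bounded[where C = "(2 * B)\<^sup>2"]) (auto simp: indicator_def)
  have disj: "disjoint_family_on A {n..m}"
  proof (unfold disjoint_family_on_def, intro ballI impI)
    fix i j assume "i \<in> {n..m}" "j \<in> {n..m}" "i \<noteq> j"
    then show "A i \<inter> A j = {}"
      unfolding A_def by (cases i j rule: linorder_cases) (force simp: not_less)+
  qed
  have "{x \<in> space M. \<exists>k\<in>{n..m}. e \<le> \<bar>X k x - X n x\<bar>} = (\<Union>k\<in>{n..m}. A k)"
  proof safe
    fix x k assume x: "x \<in> space M" "k \<in> {n..m}" "e \<le> \<bar>X k x - X n x\<bar>"
    obtain l where l: "n \<le> l" "e \<le> \<bar>X l x - X n x\<bar>" "l \<le> k"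
      and least: "\<And>j. j < l \<Longrightarrow> \<not> (n \<le> j \<and> e \<le> \<bar>X j x - X n x\<bar>)"
      using exists_least_iff[of "\<lambda>k. n \<le> k \<and> e \<le> \<bar>X k x - X n x\<bar>"] x
      by (metis atLeastAtMost_iff not_le)
    have "\<bar>X j x - X n x\<bar> < e" if "j \<in> {n..<l}" for j
      using least[of j] that by auto
    with l show "x \<in> (\<Union>k\<in>{n..m}. A k)"
      using x by (intro UN_I[of l]) (auto simp: A_def)
  qed (auto simp: A_def)
  then have "e\<^sup>2 * prob {x \<in> space M. \<exists>k\<in>{n..m}. e \<le> \<bar>X k x - X n x\<bar>} = (\<Sum>k\<in>{n..m}. e\<^sup>2 * prob (A k))"
    using AM by (simp add: finite_measure_finite_Union[OF _ _ disj] image_subset_iff sum_distrib_left)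
  also have "\<dots> \<le> (\<Sum>k\<in>{n..m}. \<integral>x. indicator (A k) x * (X m x - X n x)\<^sup>2 \<partial>M)"
  proof (rule sum_mono)
    fix k assume k: "k \<in> {n..m}"
    have "e\<^sup>2 * prob (A k) = (\<integral>x. e\<^sup>2 * indicator (A k) x \<partial>M)"
      using AM k by simp
    also have "\<dots> \<le> (\<integral>x. indicator (A k) x * (X k x - X n x)\<^sup>2 \<partial>M)"
    proof (rule integral_mono)
      show "integrable M (\<lambda>x. indicator (A k) x * (X k x - X n x)\<^sup>2)"
        using X_diff_square_bound[of k _ n] AM k
        by (intro integrable_bounded[where C = "(2 * B)\<^sup>2"]) (auto simp: indicator_def)
      show "e\<^sup>2 * indicator (A k) x \<le> indicator (A k) x * (X k x - X n x)\<^sup>2" for x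
        using assms power_mono[of e "\<bar>X k x - X n x\<bar>" 2] by (auto simp: indicator_def A_def)
    qed (use AM[of k] k in \<open>auto simp: integrable_indicator_iff emeasure_eq_measure\<close>)
    also have "\<dots> \<le> (\<integral>x. indicator (A k) x * (X m x - X n x)\<^sup>2 \<partial>M)"
      using k AF[of k] by (intro integral_square_diff) (auto simp: indicator_def)
    finally show "e\<^sup>2 * prob (A k) \<le> (\<integral>x. indicator (A k) x * (X m x - X n x)\<^sup>2 \<partial>M)" .
  qed
  also have "\<dots> = (\<integral>x. (\<Sum>k\<in>{n..m}. indicator (A k) x * (X m x - X n x)\<^sup>2) \<partial>M)"
    by (rule Bochner_Integration.integral_sum[symmetric]) (rule int)
  also have "\<dots> \<le> (\<integral>x. (X m x - X n x)\<^sup>2 \<partial>M)"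
  proof (rule integral_mono)
    show "integrable M (\<lambda>x. \<Sum>k\<in>{n..m}. indicator (A k) x * (X m x - X n x)\<^sup>2)"
      by (rule Bochner_Integration.integrable_sum) (rule int)
    show "integrable M (\<lambda>x. (X m x - X n x)\<^sup>2)"
      using X_diff_square_bound[of m _ n]
      by (intro integrable_bounded[where C = "(2 * B)\<^sup>2"]) auto
    fix x
    have "(\<Sum>k\<in>{n..m}. indicator (A k) x) = (indicator (\<Union>k\<in>{n..m}. A k) x :: real)"
      using disj by (simp add: indicator_UN_disjoint)
    then have "(\<Sum>k\<in>{n..m}. indicator (A k) x * (X m x - X n x)\<^sup>2) \<le> 1 * (X m x - X n x)\<^sup>2"
      unfolding sum_distrib_right[symmetric] by (intro mult_right_mono) (auto simp: indicator_def)
    then show "(\<Sum>k\<in>{n..m}. indicator (A k) x * (X m x - X n x)\<^sup>2) \<le> (X m x - X n x)\<^sup>2" by simp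
  qed
  also have "\<dots> = second_moment m - second_moment n"
    by (rule integral_increment[OF assms(1)])
  finally show ?thesis .
qed

text \<open>The second moments increase to a limit \<open>L\<close>. The maximal inequality bounds
  the probability of a deviation of \<open>e\<close> from \<open>X n\<close> at any later time by
  \<open>(L - second_moment n) / e\<^sup>2\<close>, which tends to \<open>0\<close>, so almost every
  path is Cauchy.\<close>

theorem AE_convergent: "AE x in M. convergent (\<lambda>n. X n x)"
proof -
  have "incseq second_moment"
  proof (rule incseq_SucI)
    fix n
    have "0 \<le> (\<integral>x. (X (Suc n) x - X n x)\<^sup>2 \<partial>M)" by simp
    then show "second_moment n \<le> second_moment (Suc n)"
      by (simp add: integral_increment)
  qed
  moreover have "second_moment n \<le> B\<^sup>2" for n
    unfolding second_moment_def
    using square_bound[of n]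
    by (intro integral_le_const integrable_bounded[where C = "B\<^sup>2"]) auto
  ultimately obtain L where L: "second_moment \<longlonglongrightarrow> L" "\<And>n. second_moment n \<le> L"
    using incseq_convergent by metis
  have "AE x in M. \<exists>n. \<forall>k\<ge>n. \<bar>X k x - X n x\<bar> < e" if e: "0 < e" for e
  proof -
    \<comment> \<open>\<open>U n m\<close> restricts the deviation to the next \<open>m\<close>
      steps, where the maximal inequality applies; these events increase to
      \<open>T n\<close>.\<close>
    define T where "T n = {x \<in> space M. \<exists>k\<ge>n. e \<le> \<bar>X k x - X n x\<bar>}" for n
    define U where "U n m = {x \<in> space M. \<exists>k\<in>{n..n+m}. e \<le> \<bar>X k x - X n x\<bar>}" for n m
    have [measurable]: "T n \<in> sets M" "U n m \<in> sets M" for n m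
      unfolding T_def U_def by measurable
    have "prob (T n) \<le> (L - second_moment n) / e\<^sup>2" for n
    proof -
      have "(\<lambda>m. prob (U n m)) \<longlonglongrightarrow> prob (\<Union>m. U n m)"
      proof (rule finite_Lim_measure_incseq)
        have "{n..n + i} \<subseteq> {n..n + j}" if "i \<le> j" for i j
          using that by auto
        then show "incseq (U n)"
          unfolding incseq_def U_def by blast
      qed auto
      moreover have "(\<Union>m. U n m) = T n"
      proof safe
        fix x assume "x \<in> T n"
        then obtain k where "x \<in> space M" "n \<le> k" "e \<le> \<bar>X k x - X n x\<bar>"
          by (auto simp: T_def)
        then have "x \<in> U n k"
          by (auto simp: U_def intro!: bexI[of _ k])
        then show "x \<in> (\<Union>m. U n m)" by blast
      qed (auto simp: U_def T_def)
      moreover have "prob (U n m) \<le> (L - second_moment n) / e\<^sup>2" for m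
        using maximal_inequality[of n "n + m" e] L(2)[of "n + m"] e
        by (simp add: U_def field_simps)
      ultimately show ?thesis
        by (auto intro: LIMSEQ_le_const2)
    qed
    moreover have "prob (\<Inter>n. T n) \<le> prob (T n)" for n
      by (intro finite_measure_mono) auto
    ultimately have "prob (\<Inter>n. T n) \<le> (L - second_moment n) / e\<^sup>2" for n
      using order_trans by blast
    moreover have "(\<lambda>n. (L - second_moment n) / e\<^sup>2) \<longlonglongrightarrow> (L - L) / e\<^sup>2"
      using e by (intro tendsto_intros L) auto
    ultimately have "prob (\<Inter>n. T n) \<le> 0"
      by (auto intro: LIMSEQ_le_const)
    then have "(\<Inter>n. T n) \<in> null_sets M"
      by (intro null_setsI) (auto simp: emeasure_eq_measure measure_le_0_iff)
    from AE_not_in[OF this] show ?thesis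
    proof (rule AE_mp[OF _ AE_I2], intro impI)
      fix x assume x: "x \<in> space M" "x \<notin> (\<Inter>n. T n)"
      then obtain n where "x \<notin> T n" by auto
      then show "\<exists>n. \<forall>k\<ge>n. \<bar>X k x - X n x\<bar> < e"
        unfolding T_def mem_Collect_eq using x(1) not_le by blast
    qed
  qed
  then have "AE x in M. \<forall>i. \<exists>n. \<forall>k\<ge>n. \<bar>X k x - X n x\<bar> < 1 / real (Suc i)"
    by (subst AE_all_countable) auto
  then show ?thesis
  proof eventually_elim
    case (elim x)
    have "Cauchy (\<lambda>n. X n x)"
    proof (rule CauchyI')
      fix e :: real assume "0 < e"
      then obtain i where i: "1 / real (Suc i) < e / 2"
        by (meson half_gt_zero nat_approx_posE)
      obtain n where n: "\<And>k. k \<ge> n \<Longrightarrow> \<bar>X k x - X n x\<bar> < 1 / real (Suc i)"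
        using elim by blast
      have "dist (X k x) (X l x) < e" if "k \<ge> n" "l \<ge> n" for k l
        using n[OF that(1)] n[OF that(2)] i unfolding dist_real_def by linarith
      then show "\<exists>N. \<forall>k\<ge>N. \<forall>l>k. dist (X k x) (X l x) < e"
        by (intro exI[of _ n]) auto
    qed
    then show ?case by (simp add: real_Cauchy_convergent Cauchy_convergent)
  qed
qed

end

subsection \<open>The quenched process\<close>

lemma space_quenched [simp]: "space (quenched \<xi>) = UNIV"
  by (simp add: quenched_def space_PiM)

lemma space_offspring_space [simp]: "space offspring_space = UNIV"
  by (simp add: offspring_space_def space_PiM)

lemma measurable_quenched_iff: "f \<in> measurable (quenched \<xi>) N \<longleftrightarrow> f \<in> measurable offspring_space N"
  by (simp cong: measurable_cong_sets add: sets_quenched)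

lemma measurable_offspring [measurable]: "(\<lambda>\<omega>. \<omega> p) \<in> measurable offspring_space (count_space UNIV)"
  unfolding offspring_space_def by measurable

lemma measurable_Z [measurable]: "Z n \<in> measurable offspring_space (count_space UNIV)"
proof (induction n)
  case (Suc n)
  note [measurable] = Suc
  have "(\<lambda>\<omega>. \<Sum>i<z. \<omega> (n, i)) \<in> measurable offspring_space (count_space UNIV)" for z
    by (induction z) auto
  then show ?case
    unfolding Z.simps
    by (rule measurable_compose_countable'[OF _ Suc]) auto
qed simp

section \<open>The filtration by generations\<close>

definition truncate :: "nat \<Rightarrow> offspring \<Rightarrow> offspring" where
  "truncate n \<omega> = (\<lambda>p. if fst p < n then \<omega> p else 0)"

text \<open>Generated by a map of the space to itself that erases the coordinates from generation
  \<open>n\<close> on. Measurability for it then amounts to ordinary measurability together with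
  invariance under \<open>truncate n\<close>.\<close>

definition generations :: "nat \<Rightarrow> offspring measure" where
  "generations n = vimage_algebra UNIV (truncate n) offspring_space"

lemma measurable_truncate: "truncate n \<in> measurable offspring_space offspring_space"
  unfolding truncate_def offspring_space_def by (rule measurable_PiM_single') auto

lemma truncate_truncate: "truncate m (truncate n \<omega>) = truncate (min m n) \<omega>"
  by (auto simp: truncate_def)

lemma sets_generations:
  "sets (generations n) = {truncate n -` A | A. A \<in> sets offspring_space}"
  by (simp add: generations_def sets_vimage_algebra2)

lemma space_generations [simp]: "space (generations n) = UNIV"
  by (simp add: generations_def)

lemma subalgebra_generations: "subalgebra (quenched \<xi>) (generations n)"
proof -
  have "truncate n -` A \<in> sets offspring_space" if "A \<in> sets offspring_space" for A
    using measurable_sets[OF measurable_truncate that] by simp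
  then show ?thesis
    by (auto simp: subalgebra_def sets_quenched sets_generations)
qed

lemma sets_generations_mono:
  assumes "m \<le> n"
  shows "sets (generations m) \<subseteq> sets (generations n)"
proof
  fix B assume "B \<in> sets (generations m)"
  then obtain A where A: "A \<in> sets offspring_space" "B = truncate m -` A"
    by (auto simp: sets_generations)
  have "B = truncate n -` (truncate m -` A)"
    using assms by (auto simp: A(2) truncate_truncate min_absorb1)
  moreover have "truncate m -` A \<in> sets offspring_space"
    using measurable_sets[OF measurable_truncate A(1)] by simp
  ultimately show "B \<in> sets (generations n)"
    unfolding sets_generations by blast
qed

text \<open>The level set of \<open>f\<close> through \<open>\<omega>\<close> is measurable, because
  points are closed, hence a preimage under \<open>truncate n\<close>. As \<open>truncate n\<close>
  is idempotent, \<open>\<omega>\<close> and \<open>truncate n \<omega>\<close> lie in the same such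
  preimages.\<close>

lemma truncate_invariant:
  fixes f :: "offspring \<Rightarrow> 'b::t1_space"
  assumes "f \<in> borel_measurable (generations n)"
  shows "f (truncate n \<omega>) = f \<omega>"
proof -
  have "f -` {f \<omega>} \<in> sets (generations n)"
    using measurable_sets[OF assms, of "{f \<omega>}"] by simp
  then obtain A where "f -` {f \<omega>} = truncate n -` A"
    by (auto simp: sets_generations)
  then have "truncate n \<omega> \<in> f -` {f \<omega>} \<longleftrightarrow> \<omega> \<in> f -` {f \<omega>}"
    by (auto simp: truncate_truncate)
  then show ?thesis by simp
qed

lemma borel_measurable_generations_iff:
  fixes f :: "offspring \<Rightarrow> 'b::t1_space"
  shows "f \<in> borel_measurable (generations n) \<longleftrightarrow>
    f \<in> borel_measurable offspring_space \<and> (\<forall>\<omega>. f (truncate n \<omega>) = f \<omega>)"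
proof safe
  assume f: "f \<in> borel_measurable (generations n)"
  have "sets (generations n) \<subseteq> sets offspring_space"
    using subalgebra_generations[of undefined n] by (auto simp: subalgebra_def sets_quenched)
  then show "f \<in> borel_measurable offspring_space"
    using f by (auto simp: measurable_def)
next
  assume f: "f \<in> borel_measurable offspring_space" "\<forall>\<omega>. f (truncate n \<omega>) = f \<omega>"
  have "f \<circ> truncate n \<in> borel_measurable (generations n)"
    unfolding generations_def
    by (rule measurable_comp[OF measurable_vimage_algebra1 f(1)]) auto
  with f(2) show "f \<in> borel_measurable (generations n)"
    by (simp add: comp_def)
qed (rule truncate_invariant)

lemma Z_truncate: "n \<le> m \<Longrightarrow> Z n (truncate m \<omega>) = Z n \<omega>"
  by (induction n) (auto simp: truncate_def)

section \<open>The branching property\<close>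

lemma distr_quenched_component:
  "distr (quenched \<xi>) (count_space UNIV) (\<lambda>\<omega>. \<omega> p) = measure_pmf (\<xi> (int (fst p)))"
proof -
  have "distr (quenched \<xi>) (count_space UNIV) (\<lambda>\<omega>. \<omega> p) =
      distr (quenched \<xi>) (measure_pmf (\<xi> (int (fst p)))) (\<lambda>\<omega>. \<omega> p)"
    by (rule distr_cong) auto
  also have "\<dots> = measure_pmf (\<xi> (int (fst p)))"
    unfolding quenched_def by (rule distr_PiM_component) (auto intro: measure_pmf.prob_space_axioms)
  finally show ?thesis .
qed

lemma indep_quenched:
  "prob_space.indep_vars (quenched \<xi>) (\<lambda>_. count_space UNIV) (\<lambda>p \<omega>. \<omega> p) UNIV"
proof -
  interpret prob_space "quenched \<xi>" by (rule prob_space_quenched)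
  have "distr (quenched \<xi>) offspring_space (\<lambda>\<omega>. \<omega>) = quenched \<xi>"
    by (intro distr_id2) (simp add: sets_quenched)
  then show ?thesis
    by (subst indep_vars_iff_distr_eq_PiM)
       (auto simp: distr_quenched_component measurable_quenched_iff restrict_UNIV offspring_space_def[symmetric] quenched_def[symmetric])
qed

lemma expectation_power_offspring:
  assumes u: "0 \<le> u" "u \<le> 1"
  shows "(\<integral>\<omega>. u ^ (\<Sum>i<z. \<omega> (n, i)) \<partial>quenched \<xi>) = pgf (\<xi> (int n)) u ^ z"
proof -
  interpret prob_space "quenched \<xi>" by (rule prob_space_quenched)
  have ind: "indep_vars (\<lambda>_. borel) (\<lambda>p \<omega>. u ^ \<omega> p) (Pair n ` {..<z})"
    by (rule indep_vars_compose2[OF indep_vars_subset[OF indep_quenched]]) auto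
  have one: "(\<integral>\<omega>. u ^ \<omega> p \<partial>quenched \<xi>) = pgf (\<xi> (int (fst p))) u" for p
  proof -
    have "(\<integral>\<omega>. u ^ \<omega> p \<partial>quenched \<xi>) =
        (\<integral>j. u ^ j \<partial>distr (quenched \<xi>) (count_space UNIV) (\<lambda>\<omega>. \<omega> p))"
      by (subst integral_distr) (auto simp: measurable_quenched_iff)
    then show ?thesis
      using u by (simp add: distr_quenched_component pgf_eq_expectation)
  qed
  have "(\<integral>\<omega>. u ^ (\<Sum>i<z. \<omega> (n, i)) \<partial>quenched \<xi>) = (\<integral>\<omega>. (\<Prod>p\<in>Pair n ` {..<z}. u ^ \<omega> p) \<partial>quenched \<xi>)"
    by (simp add: power_sum prod.reindex inj_on_def)
  also have "\<dots> = (\<Prod>p\<in>Pair n ` {..<z}. \<integral>\<omega>. u ^ \<omega> p \<partial>quenched \<xi>)"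
    by (rule indep_vars_lebesgue_integral[OF _ ind])
       (auto intro!: integrable_const_bound[of _ 1] simp: measurable_quenched_iff power_le_one u)
  also have "\<dots> = pgf (\<xi> (int n)) u ^ z"
    by (simp add: one prod.reindex inj_on_def)
  finally show ?thesis .
qed

text \<open>On \<open>Z n = z\<close> the next generation is a sum of the fixed number
  \<open>z\<close> of coordinates of generation \<open>n\<close>. These are independent of the
  earlier coordinates, which determine \<open>Y\<close> and \<open>Z n\<close>, so the expectation
  factors.\<close>

lemma expectation_power_Z_Suc_on:
  assumes u: "0 \<le> u" "u \<le> 1" and Y: "Y \<in> borel_measurable (generations n)" "\<And>\<omega>. \<bar>Y \<omega>\<bar> \<le> C"
  shows "(\<integral>\<omega>. Y \<omega> * of_bool (Z n \<omega> = z) * u ^ Z (Suc n) \<omega> \<partial>quenched \<xi>) =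
    (\<integral>\<omega>. Y \<omega> * of_bool (Z n \<omega> = z) * pgf (\<xi> (int n)) u ^ Z n \<omega> \<partial>quenched \<xi>)"
proof -
  interpret prob_space "quenched \<xi>" by (rule prob_space_quenched)
  have [measurable]: "Y \<in> borel_measurable offspring_space"
    and Yt: "Y (truncate n \<omega>) = Y \<omega>" for \<omega>
    using Y(1) by (auto simp: borel_measurable_generations_iff)
  let ?I = "{p. fst p < n} :: (nat \<times> nat) set" and ?J = "{p. fst p = n} :: (nat \<times> nat) set"
  let ?V = "\<lambda>\<omega>. Y \<omega> * of_bool (Z n \<omega> = z)" and ?U = "\<lambda>\<omega>::offspring. u ^ (\<Sum>i<z. \<omega> (n, i))"
  \<comment> \<open>Filling the coordinates outside \<open>?I\<close> with \<open>0\<close> turns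
    the restriction to \<open>?I\<close> into \<open>truncate n\<close>; so \<open>?V\<close>, which
    is invariant under \<open>truncate n\<close>, is a function of the coordinates in
    \<open>?I\<close>.\<close>
  let ?ext = "\<lambda>\<omega> p. if p \<in> ?I then \<omega> p else (0::nat)"
  have "(\<lambda>\<omega>. ?ext \<omega>) \<in> measurable (PiM ?I (\<lambda>_. count_space UNIV)) offspring_space"
    unfolding offspring_space_def
  proof (rule measurable_PiM_single')
    show "(\<lambda>\<omega>. ?ext \<omega> p) \<in> measurable (PiM ?I (\<lambda>_. count_space UNIV)) (count_space UNIV)" for p
      by (cases "fst p < n") auto
  qed (auto simp: space_PiM)
  moreover have "?V \<in> borel_measurable offspring_space" by measurable
  ultimately have 1: "(\<lambda>\<omega>. ?V (?ext \<omega>)) \<in> borel_measurable (PiM ?I (\<lambda>_. count_space UNIV))"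
    by (rule measurable_compose)
  have 2: "?U \<in> borel_measurable (PiM ?J (\<lambda>_. count_space UNIV))"
    unfolding power_sum by measurable
  have "indep_var borel ((\<lambda>\<omega>. ?V (?ext \<omega>)) \<circ> (\<lambda>\<omega>. restrict (\<lambda>p. \<omega> p) ?I))
      borel (?U \<circ> (\<lambda>\<omega>. restrict (\<lambda>p. \<omega> p) ?J))"
    by (rule indep_var_compose[OF indep_var_restrict[OF indep_quenched] 1 2]) auto
  moreover have "?ext (restrict \<omega> ?I) = truncate n \<omega>" for \<omega>
    by (auto simp: truncate_def)
  then have "(\<lambda>\<omega>. ?V (?ext \<omega>)) \<circ> (\<lambda>\<omega>. restrict (\<lambda>p. \<omega> p) ?I) = ?V"
    by (auto simp: Yt Z_truncate)
  moreover have "?U \<circ> (\<lambda>\<omega>. restrict (\<lambda>p. \<omega> p) ?J) = ?U"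
    by (auto simp: fun_eq_iff)
  ultimately have ind: "indep_var borel ?V borel ?U" by simp
  have "\<bar>?V \<omega>\<bar> \<le> C" for \<omega>
    using Y(2)[of \<omega>] by (auto simp: abs_mult)
  then have V: "integrable (quenched \<xi>) ?V"
    by (intro integrable_const_bound[of _ C]) (auto simp: measurable_quenched_iff)
  have U: "integrable (quenched \<xi>) ?U"
    by (intro integrable_const_bound[of _ 1]) (auto simp: measurable_quenched_iff u power_le_one)
  have "(\<integral>\<omega>. Y \<omega> * of_bool (Z n \<omega> = z) * u ^ Z (Suc n) \<omega> \<partial>quenched \<xi>) = (\<integral>\<omega>. ?V \<omega> * ?U \<omega> \<partial>quenched \<xi>)"
    by (intro Bochner_Integration.integral_cong) auto
  also have "\<dots> = (\<integral>\<omega>. ?V \<omega> \<partial>quenched \<xi>) * (\<integral>\<omega>. ?U \<omega> \<partial>quenched \<xi>)"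
    by (rule indep_var_lebesgue_integral[OF ind V U])
  also have "\<dots> = (\<integral>\<omega>. ?V \<omega> * pgf (\<xi> (int n)) u ^ z \<partial>quenched \<xi>)"
    by (simp add: expectation_power_offspring[OF u])
  also have "\<dots> = (\<integral>\<omega>. Y \<omega> * of_bool (Z n \<omega> = z) * pgf (\<xi> (int n)) u ^ Z n \<omega> \<partial>quenched \<xi>)"
    by (intro Bochner_Integration.integral_cong) auto
  finally show ?thesis .
qed

text \<open>The previous identity is summed over the values \<open>z\<close> of \<open>Z n\<close>,
  with dominated convergence for the infinitely many values. The result says that, conditionally on
  \<open>generations n\<close>, \<open>u ^ Z (Suc n)\<close> has mean
  \<open>pgf (\<xi> (int n)) u ^ Z n\<close>.\<close>

lemma expectation_power_Z_Suc:
  assumes u: "0 \<le> u" "u \<le> 1" and Y: "Y \<in> borel_measurable (generations n)" "\<And>\<omega>. \<bar>Y \<omega>\<bar> \<le> C"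
  shows "(\<integral>\<omega>. Y \<omega> * u ^ Z (Suc n) \<omega> \<partial>quenched \<xi>) =
    (\<integral>\<omega>. Y \<omega> * pgf (\<xi> (int n)) u ^ Z n \<omega> \<partial>quenched \<xi>)"
proof -
  interpret prob_space "quenched \<xi>" by (rule prob_space_quenched)
  have [measurable]: "Y \<in> borel_measurable offspring_space"
    using Y(1) by (auto simp: borel_measurable_generations_iff)
  have lim: "(\<lambda>N. \<Sum>z<N. \<integral>\<omega>. Y \<omega> * of_bool (Z n \<omega> = z) * v ^ Z m \<omega> \<partial>quenched \<xi>)
      \<longlonglongrightarrow> (\<integral>\<omega>. Y \<omega> * v ^ Z m \<omega> \<partial>quenched \<xi>)" if v: "0 \<le> v" "v \<le> 1" for v m
  proof -
    have b: "\<bar>Y \<omega> * v ^ Z m \<omega>\<bar> \<le> C" for \<omega>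
      using mult_mono[OF Y(2)[of \<omega>] power_le_one[OF v, of "Z m \<omega>"]] v Y(2)[of \<omega>]
      by (simp add: abs_mult)
    have "C \<ge> 0" using Y(2)[of undefined] by linarith
    have int: "integrable (quenched \<xi>) (\<lambda>\<omega>. Y \<omega> * of_bool (Z n \<omega> = z) * v ^ Z m \<omega>)" for z
      by (rule integrable_const_bound[of _ C])
         (use b \<open>C \<ge> 0\<close> in \<open>auto simp: measurable_quenched_iff of_bool_def\<close>)
    have "(\<lambda>N. \<integral>\<omega>. Y \<omega> * of_bool (Z n \<omega> < N) * v ^ Z m \<omega> \<partial>quenched \<xi>)
        \<longlonglongrightarrow> (\<integral>\<omega>. Y \<omega> * v ^ Z m \<omega> \<partial>quenched \<xi>)"
    proof (rule integral_dominated_convergence[where w = "\<lambda>_. C"])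
      show "AE \<omega> in quenched \<xi>. (\<lambda>N. Y \<omega> * of_bool (Z n \<omega> < N) * v ^ Z m \<omega>) \<longlonglongrightarrow> Y \<omega> * v ^ Z m \<omega>"
      proof (rule AE_I2)
        fix \<omega>
        have "eventually (\<lambda>N. Y \<omega> * of_bool (Z n \<omega> < N) * v ^ Z m \<omega> = Y \<omega> * v ^ Z m \<omega>) sequentially"
          using eventually_gt_at_top[of "Z n \<omega>"] by eventually_elim simp
        then show "(\<lambda>N. Y \<omega> * of_bool (Z n \<omega> < N) * v ^ Z m \<omega>) \<longlonglongrightarrow> Y \<omega> * v ^ Z m \<omega>"
          by (rule tendsto_eventually)
      qed
    qed (use b \<open>C \<ge> 0\<close> in \<open>auto simp: measurable_quenched_iff of_bool_def\<close>)
    also have "(\<lambda>N. \<integral>\<omega>. Y \<omega> * of_bool (Z n \<omega> < N) * v ^ Z m \<omega> \<partial>quenched \<xi>) =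
        (\<lambda>N. \<Sum>z<N. \<integral>\<omega>. Y \<omega> * of_bool (Z n \<omega> = z) * v ^ Z m \<omega> \<partial>quenched \<xi>)"
    proof
      fix N
      have "Y \<omega> * of_bool (Z n \<omega> < N) * v ^ Z m \<omega> = (\<Sum>z<N. Y \<omega> * of_bool (Z n \<omega> = z) * v ^ Z m \<omega>)" for \<omega>
        by (simp add: of_bool_def if_distrib if_distribR sum.If_cases cong: if_cong) 
      then show "(\<integral>\<omega>. Y \<omega> * of_bool (Z n \<omega> < N) * v ^ Z m \<omega> \<partial>quenched \<xi>) =
          (\<Sum>z<N. \<integral>\<omega>. Y \<omega> * of_bool (Z n \<omega> = z) * v ^ Z m \<omega> \<partial>quenched \<xi>)"
        using int by (simp add: Bochner_Integration.integral_sum)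
    qed
    finally show ?thesis .
  qed
  have "(\<lambda>N. \<Sum>z<N. \<integral>\<omega>. Y \<omega> * of_bool (Z n \<omega> = z) * u ^ Z (Suc n) \<omega> \<partial>quenched \<xi>)
      \<longlonglongrightarrow> (\<integral>\<omega>. Y \<omega> * pgf (\<xi> (int n)) u ^ Z n \<omega> \<partial>quenched \<xi>)"
    unfolding expectation_power_Z_Suc_on[OF u Y]
    using u by (intro lim pgf_nonneg pgf_le_1)
  then show ?thesis
    using lim[OF u, of "Suc n"] LIMSEQ_unique by blast
qed

text \<open>The generating function of \<open>Z n\<close>, the composition of the
  \<open>pgf (\<xi> (int i))\<close> for \<open>i < n\<close> with \<open>i = 0\<close> outermost.
  The recursion adds the innermost function, matching the conditioning in
  \<open>expectation_power_Z_Suc\<close>.\<close>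

primrec pgf_iter :: "nat \<Rightarrow> environment \<Rightarrow> real \<Rightarrow> real" where
  "pgf_iter 0 \<xi> u = u"
| "pgf_iter (Suc n) \<xi> u = pgf_iter n \<xi> (pgf (\<xi> (int n)) u)"

lemma expectation_power_Z:
  "0 \<le> u \<Longrightarrow> u \<le> 1 \<Longrightarrow> (\<integral>\<omega>. u ^ Z n \<omega> \<partial>quenched \<xi>) = pgf_iter n \<xi> u"
proof (induction n arbitrary: u)
  case 0
  interpret prob_space "quenched \<xi>" by (rule prob_space_quenched)
  show ?case by (simp add: prob_space del: space_quenched)
next
  case (Suc n)
  then show ?case
    using expectation_power_Z_Suc[of u "\<lambda>_. 1" n 1 \<xi>] by (simp add: pgf_nonneg pgf_le_1 del: Z.simps)
qed

lemma pgf_iter_Suc_shift: "pgf_iter (Suc n) \<xi> u = pgf (\<xi> 0) (pgf_iter n (shift \<xi>) u)"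
  by (induction n arbitrary: u) (simp_all add: shift_def add.commute)

lemma pgf_iter_in: "u \<in> {0..1} \<Longrightarrow> pgf_iter n \<xi> u \<in> {0..1}"
  by (induction n arbitrary: u) (auto simp: pgf_nonneg pgf_le_1)

lemma pgf_iter_mono: "0 \<le> u \<Longrightarrow> u \<le> v \<Longrightarrow> v \<le> 1 \<Longrightarrow> pgf_iter n \<xi> u \<le> pgf_iter n \<xi> v"
  by (induction n arbitrary: u v) (auto simp: pgf_nonneg pgf_le_1 pgf_mono)

lemma pgf_iter_exp_h: "\<xi> \<in> no_death \<Longrightarrow> 0 < s \<Longrightarrow> pgf_iter n \<xi> (exp (- h n \<xi> s)) = exp (- s)"
  by (induction n) (auto simp: pgf_exp_h1 no_deathD h_pos)

lemma bounded_martingale_exp_Z: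
  assumes \<xi>: "\<xi> \<in> no_death" and s: "0 < s"
  shows "bounded_martingale (quenched \<xi>) generations (\<lambda>n \<omega>. exp (- h n \<xi> s) ^ Z n \<omega>) 1"
proof -
  interpret prob_space "quenched \<xi>" by (rule prob_space_quenched)
  have h: "exp (- h n \<xi> s) \<le> 1" for n
    using h_pos[OF \<xi> s, of n] by simp
  show ?thesis
  proof
    show "(\<lambda>\<omega>. exp (- h n \<xi> s) ^ Z n \<omega>) \<in> borel_measurable (generations n)" for n
      by (simp add: borel_measurable_generations_iff Z_truncate)
    show "\<bar>exp (- h n \<xi> s) ^ Z n \<omega>\<bar> \<le> 1" for n \<omega>
      using h[of n] by (simp add: power_le_one)
    show "(\<integral>\<omega>. Y \<omega> * exp (- h (Suc n) \<xi> s) ^ Z (Suc n) \<omega> \<partial>quenched \<xi>) =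
        (\<integral>\<omega>. Y \<omega> * exp (- h n \<xi> s) ^ Z n \<omega> \<partial>quenched \<xi>)"
      if "Y \<in> borel_measurable (generations n)" "\<And>\<omega>. \<bar>Y \<omega>\<bar> \<le> C" for n Y C
      using expectation_power_Z_Suc[OF _ h[of "Suc n"] that, of \<xi>] h_pos[OF \<xi> s]
      by (simp add: pgf_exp_h1 no_deathD[OF \<xi>] del: Z.simps)
  qed (auto simp: subalgebra_generations sets_generations_mono[THEN subsetD])
qed

subsection \<open>The limit of the martingale\<close>

definition mart_lim :: "environment \<Rightarrow> real \<Rightarrow> offspring \<Rightarrow> real" where
  "mart_lim \<xi> s \<omega> = lim (\<lambda>n. exp (- h n \<xi> s) ^ Z n \<omega>)"

text \<open>With \<open>mart_lim = exp (- W)\<close> the integrand is \<open>exp (- r * W)\<close>;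
  the convention \<open>0 powr r = 0\<close> gives it the value \<open>0\<close> where
  \<open>W = \<infinity>\<close>.\<close>

definition laplace :: "environment \<Rightarrow> real \<Rightarrow> real \<Rightarrow> real" where
  "laplace \<xi> s r = (\<integral>\<omega>. mart_lim \<xi> s \<omega> powr r \<partial>quenched \<xi>)"

lemma mart_lim_measurable [measurable]: "mart_lim \<xi> s \<in> borel_measurable (quenched \<xi>)"
  unfolding mart_lim_def[abs_def] by (simp add: measurable_quenched_iff)

lemma AE_mart_lim:
  assumes \<xi>: "\<xi> \<in> no_death" and s: "0 < s"
  shows "AE \<omega> in quenched \<xi>. (\<lambda>n. exp (- h n \<xi> s) ^ Z n \<omega>) \<longlonglongrightarrow> mart_lim \<xi> s \<omega> \<and>
    mart_lim \<xi> s \<omega> \<in> {0..1}"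
  using bounded_martingale.AE_convergent[OF bounded_martingale_exp_Z[OF \<xi> s]]
proof eventually_elim
  case (elim \<omega>)
  then have lim: "(\<lambda>n. exp (- h n \<xi> s) ^ Z n \<omega>) \<longlonglongrightarrow> mart_lim \<xi> s \<omega>"
    by (simp add: convergent_LIMSEQ_iff mart_lim_def)
  moreover have "exp (- h n \<xi> s) ^ Z n \<omega> \<in> {0..1}" for n
    using h_pos[OF \<xi> s, of n] by (simp add: power_le_one)
  then have "mart_lim \<xi> s \<omega> \<in> {0..1}"
    by (intro closed_sequentially[OF _ _ lim]) auto
  ultimately show ?case by simp
qed

text \<open>The factor \<open>r\<close> becomes a power, since
  \<open>exp (- (r * h)) ^ Z n = (exp (- h) ^ Z n) powr r\<close>. The expectation of this is the
  generating function of \<open>Z n\<close> at \<open>exp (- (r * h))\<close>, and dominated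
  convergence applies.\<close>

lemma tendsto_laplace:
  assumes \<xi>: "\<xi> \<in> no_death" and s: "0 < s" and r: "0 < r"
  shows "(\<lambda>n. pgf_iter n \<xi> (exp (- (r * h n \<xi> s)))) \<longlonglongrightarrow> laplace \<xi> s r"
proof -
  interpret prob_space "quenched \<xi>" by (rule prob_space_quenched)
  have pos: "0 \<le> r * h n \<xi> s" for n
    using h_pos[OF \<xi> s, of n] r by simp
  have eq: "exp (- (r * h n \<xi> s)) ^ Z n \<omega> = (exp (- h n \<xi> s) ^ Z n \<omega>) powr r" for n \<omega>
    by (simp add: powr_def ln_realpow flip: exp_of_nat_mult)
  have [measurable]: "mart_lim \<xi> s \<in> borel_measurable offspring_space"
    using mart_lim_measurable by (simp add: measurable_quenched_iff)
  have "(\<lambda>n. \<integral>\<omega>. exp (- (r * h n \<xi> s)) ^ Z n \<omega> \<partial>quenched \<xi>) \<longlonglongrightarrow> laplace \<xi> s r"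
    unfolding laplace_def
  proof (rule integral_dominated_convergence[where w = "\<lambda>_. 1"])
    show "AE \<omega> in quenched \<xi>. (\<lambda>n. exp (- (r * h n \<xi> s)) ^ Z n \<omega>) \<longlonglongrightarrow> mart_lim \<xi> s \<omega> powr r"
      using AE_mart_lim[OF \<xi> s]
    proof eventually_elim
      case (elim \<omega>)
      then show ?case
        unfolding eq using r by (intro tendsto_powr') auto
    qed
    show "AE \<omega> in quenched \<xi>. norm (exp (- (r * h n \<xi> s)) ^ Z n \<omega>) \<le> 1" for n
      using pos[of n] by (simp add: power_le_one)
  qed (auto simp: measurable_quenched_iff)
  then show ?thesis
    using pos by (simp add: expectation_power_Z)
qed

lemma laplace_1: "\<xi> \<in> no_death \<Longrightarrow> 0 < s \<Longrightarrow> laplace \<xi> s 1 = exp (- s)"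
  using tendsto_laplace[of \<xi> s 1] by (simp add: pgf_iter_exp_h LIMSEQ_const_iff)

lemma laplace_in:
  assumes "\<xi> \<in> no_death" "0 < s" "0 < r"
  shows "laplace \<xi> s r \<in> {0..1}"
  using assms h_pos
  by (intro closed_sequentially[OF _ _ tendsto_laplace] pgf_iter_in)
     (auto intro!: mult_nonneg_nonneg less_imp_le)

lemma laplace_shift:
  assumes \<xi>: "\<xi> \<in> no_death" and s: "0 < s" and r: "0 < r"
  shows "laplace \<xi> s r = pgf (\<xi> 0) (laplace (shift \<xi>) (h1 (\<xi> 0) s) r)"
proof (rule LIMSEQ_unique)
  note \<xi>' = shift_in_no_death[OF \<xi>] and t = h1_pos[OF no_deathD0[OF \<xi>] s]
  show "(\<lambda>n. pgf_iter (Suc n) \<xi> (exp (- (r * h (Suc n) \<xi> s)))) \<longlonglongrightarrow> laplace \<xi> s r"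
    using tendsto_laplace[OF \<xi> s r] by (rule LIMSEQ_Suc)
  show "(\<lambda>n. pgf_iter (Suc n) \<xi> (exp (- (r * h (Suc n) \<xi> s))))
      \<longlonglongrightarrow> pgf (\<xi> 0) (laplace (shift \<xi>) (h1 (\<xi> 0) s) r)"
    unfolding pgf_iter_Suc_shift h_Suc_shift using h_pos[OF \<xi>' t] r
    by (intro tendsto_pgf tendsto_laplace[OF \<xi>' t r] pgf_iter_in) (auto intro!: mult_nonneg_nonneg less_imp_le)
qed

text \<open>If \<open>d \<xi> s = 0\<close>, then \<open>r * h (Suc n) \<xi> s\<close> is eventually below \<open>e * h n (shift \<xi>) s\<close>, however
  large \<open>r\<close> and however small \<open>e\<close> may be.\<close>

lemma laplace_ge_shift:
  assumes \<xi>: "\<xi> \<in> no_death" and s: "0 < s" and r: "0 < r" and e: "0 < e" and d: "d \<xi> s = 0"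
  shows "pgf (\<xi> 0) (laplace (shift \<xi>) s e) \<le> laplace \<xi> s r"
proof (rule tendsto_le)
  note \<xi>' = shift_in_no_death[OF \<xi>]
  have in01: "exp (- (c * h n \<zeta> s)) \<in> {0..1}" if "\<zeta> \<in> no_death" "0 < c" for c n \<zeta>
    using h_pos[OF that(1) s, of n] that(2) by simp
  show "(\<lambda>n. pgf_iter (Suc n) \<xi> (exp (- (r * h (Suc n) \<xi> s)))) \<longlonglongrightarrow> laplace \<xi> s r"
    using tendsto_laplace[OF \<xi> s r] by (rule LIMSEQ_Suc)
  show "(\<lambda>n. pgf (\<xi> 0) (pgf_iter n (shift \<xi>) (exp (- (e * h n (shift \<xi>) s)))))
      \<longlonglongrightarrow> pgf (\<xi> 0) (laplace (shift \<xi>) s e)"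
    by (intro tendsto_pgf tendsto_laplace[OF \<xi>' s e] pgf_iter_in in01 \<xi>' e)
  have "eventually (\<lambda>n. h (Suc n) \<xi> s / h n (shift \<xi>) s < e / r) sequentially"
    using h_ratio_tendsto_d[OF \<xi> s] d e r by (intro order_tendstoD) auto
  then show "eventually (\<lambda>n. pgf (\<xi> 0) (pgf_iter n (shift \<xi>) (exp (- (e * h n (shift \<xi>) s)))) \<le>
      pgf_iter (Suc n) \<xi> (exp (- (r * h (Suc n) \<xi> s)))) sequentially"
  proof eventually_elim
    case (elim n)
    then have "r * h (Suc n) \<xi> s \<le> e * h n (shift \<xi>) s"
      using h_pos[OF \<xi>' s, of n] r by (simp add: field_simps del: h.simps)
    then have "exp (- (e * h n (shift \<xi>) s)) \<le> exp (- (r * h (Suc n) \<xi> s))"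
      by simp
    then show ?case
      unfolding pgf_iter_Suc_shift
      using pgf_iter_in[OF in01[OF \<xi>' e, of n], of n "shift \<xi>"]
        pgf_iter_in[OF in01[OF \<xi> r, of "Suc n"], of n "shift \<xi>"] in01[OF \<xi> r, of "Suc n"]
      by (intro pgf_mono pgf_iter_mono) (auto simp del: h.simps)
  qed
qed simp

section \<open>Bounds on the Laplace transform that are uniform in \<open>r\<close>\<close>

definition laplace_bounded_below :: "environment \<Rightarrow> bool" where
  "laplace_bounded_below \<xi> \<longleftrightarrow> (\<forall>s>0. \<exists>c>0. \<forall>r>0. c \<le> laplace \<xi> s r)"

text \<open>Both bounds are uniform in \<open>r\<close>, so that the lower one survives
  \<open>r \<rightarrow> \<infinity>\<close> and the upper one \<open>r \<rightarrow> 0\<close>.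
  They are required for all \<open>s\<close>, because the bound for \<open>\<xi>\<close> at
  \<open>s\<close> is drawn from the one for \<open>shift \<xi>\<close> at
  \<open>h1 (\<xi> 0) s\<close>.\<close>

definition laplace_bounded_above :: "environment \<Rightarrow> bool" where
  "laplace_bounded_above \<xi> \<longleftrightarrow> (\<forall>s>0. \<exists>c\<in>{0..<1}. \<forall>r>0. laplace \<xi> s r \<le> c)"

lemma laplace_bounded_below_D:
  assumes \<xi>: "\<xi> \<in> no_death" "\<xi> \<in> D"
  shows "laplace_bounded_below \<xi>"
  unfolding laplace_bounded_below_def
proof (intro allI impI)
  fix s :: real assume s: "0 < s"
  \<comment> \<open>The choice \<open>e = 1\<close> makes the left side of
    \<open>laplace_ge_shift\<close> explicit and free of \<open>r\<close>.\<close>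
  have "pgf (\<xi> 0) (exp (- s)) \<le> laplace \<xi> s r" if "0 < r" for r
    using laplace_ge_shift[OF \<xi>(1) s that, of 1] \<xi>(2) s
    by (simp add: D_def laplace_1 shift_in_no_death \<xi>(1))
  moreover have "0 < pgf (\<xi> 0) (exp (- s))"
    using s by (intro pgf_pos) auto
  ultimately show "\<exists>c>0. \<forall>r>0. c \<le> laplace \<xi> s r" by blast
qed

text \<open>For \<open>r = 1\<close> the right side of \<open>laplace_ge_shift\<close> is
  \<open>exp (- s) = pgf (\<xi> 0) (exp (- h1 (\<xi> 0) s))\<close>, and
  \<open>pgf (\<xi> 0)\<close> cancels. The bound obtained concerns \<open>shift \<xi>\<close>;
  \<open>laplace_bounded_above_shiftD\<close> carries it back to \<open>\<xi>\<close>.\<close>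

lemma laplace_bounded_above_shift_D:
  assumes \<xi>: "\<xi> \<in> no_death" "\<xi> \<in> D"
  shows "laplace_bounded_above (shift \<xi>)"
  unfolding laplace_bounded_above_def
proof (intro allI impI)
  fix s :: real assume s: "0 < s"
  note t = h1[OF no_deathD0[OF \<xi>(1)] s]
  have "laplace (shift \<xi>) s r \<le> exp (- h1 (\<xi> 0) s)" if r: "0 < r" for r
  proof -
    have "pgf (\<xi> 0) (laplace (shift \<xi>) s r) \<le> pgf (\<xi> 0) (exp (- h1 (\<xi> 0) s))"
      using laplace_ge_shift[OF \<xi>(1) s zero_less_one r] \<xi> s t(2) by (simp add: D_def laplace_1)
    then show ?thesis
      using laplace_in[OF shift_in_no_death[OF \<xi>(1)] s r] t(1) no_deathD0[OF \<xi>(1)]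
      by (subst (asm) pgf_le_cancel) auto
  qed
  moreover have "exp (- h1 (\<xi> 0) s) \<in> {0..<1}"
    using t(1) by simp
  ultimately show "\<exists>c\<in>{0..<1}. \<forall>r>0. laplace (shift \<xi>) s r \<le> c" by blast
qed

lemma laplace_bounded_below_shiftD:
  assumes \<xi>: "\<xi> \<in> no_death" "laplace_bounded_below (shift \<xi>)"
  shows "laplace_bounded_below \<xi>"
  unfolding laplace_bounded_below_def
proof (intro allI impI)
  fix s :: real assume s: "0 < s"
  note t = h1_pos[OF no_deathD0[OF \<xi>(1)] s]
  obtain c where c: "0 < c" "\<And>r. 0 < r \<Longrightarrow> c \<le> laplace (shift \<xi>) (h1 (\<xi> 0) s) r"
    using \<xi>(2) t unfolding laplace_bounded_below_def by metis
  note in01 = laplace_in[OF shift_in_no_death[OF \<xi>(1)] t]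
  have "pgf (\<xi> 0) c \<le> laplace \<xi> s r" if "0 < r" for r
    unfolding laplace_shift[OF \<xi>(1) s that]
    using c in01[OF that] that by (intro pgf_mono) auto
  moreover have "c \<le> 1"
    using c(2)[of 1] in01[of 1] by auto
  with c have "0 < pgf (\<xi> 0) c" by (intro pgf_pos)
  ultimately show "\<exists>c>0. \<forall>r>0. c \<le> laplace \<xi> s r" by blast
qed

lemma laplace_bounded_above_shiftD:
  assumes \<xi>: "\<xi> \<in> no_death" "laplace_bounded_above (shift \<xi>)"
  shows "laplace_bounded_above \<xi>"
  unfolding laplace_bounded_above_def
proof (intro allI impI)
  fix s :: real assume s: "0 < s"
  note t = h1_pos[OF no_deathD0[OF \<xi>(1)] s]
  obtain c where c: "c \<in> {0..<1}" "\<And>r. 0 < r \<Longrightarrow> laplace (shift \<xi>) (h1 (\<xi> 0) s) r \<le> c"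
    using \<xi>(2) t unfolding laplace_bounded_above_def by metis
  have "laplace \<xi> s r \<le> pgf (\<xi> 0) c" if "0 < r" for r
    unfolding laplace_shift[OF \<xi>(1) s that]
    using c laplace_in[OF shift_in_no_death[OF \<xi>(1)] t that] that by (intro pgf_mono) auto
  moreover have "pgf (\<xi> 0) c \<in> {0..<1}"
    using c(1) pgf_nonneg[of c "\<xi> 0"] pgf_le_arg[OF no_deathD0[OF \<xi>(1)], of c] by auto
  ultimately show "\<exists>c\<in>{0..<1}. \<forall>r>0. laplace \<xi> s r \<le> c" by blast
qed

lemma laplace_bounded_funpow_shift:
  assumes "\<xi> \<in> no_death" "(shift ^^ k) \<xi> \<in> D"
  shows "laplace_bounded_below \<xi> \<and> laplace_bounded_above \<xi>"
  using assms
proof (induction k arbitrary: \<xi>)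
  case 0
  then show ?case
    using laplace_bounded_below_D laplace_bounded_above_shift_D laplace_bounded_above_shiftD by simp
next
  case (Suc k)
  then have "laplace_bounded_below (shift \<xi>) \<and> laplace_bounded_above (shift \<xi>)"
    by (intro Suc.IH shift_in_no_death) (simp_all add: funpow_swap1)
  then show ?case
    using laplace_bounded_below_shiftD laplace_bounded_above_shiftD Suc.prems(1) by blast
qed

text \<open>As \<open>r \<rightarrow> \<infinity>\<close>, \<open>x powr r\<close> tends to the
  indicator of \<open>x = 1\<close> for \<open>x\<close> in \<open>{0..1}\<close>, so the
  probability is the limit of \<open>laplace \<xi> s r\<close> and inherits the lower bound. The
  event is written with \<open>\<le>\<close> to match \<open>neg_ln_eq_0_iff\<close>; almost surely
  it means equality.\<close>

lemma prob_mart_lim_eq_1_pos: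
  assumes \<xi>: "\<xi> \<in> no_death" and s: "0 < s" and "laplace_bounded_below \<xi>"
  shows "0 < measure (quenched \<xi>) {\<omega>. 1 \<le> mart_lim \<xi> s \<omega>}"
proof -
  interpret prob_space "quenched \<xi>" by (rule prob_space_quenched)
  let ?E = "{\<omega>. 1 \<le> mart_lim \<xi> s \<omega>}"
  have [measurable]: "?E \<in> sets (quenched \<xi>)"
    using measurable_sets[OF mart_lim_measurable, of "{1..}" \<xi> s] by (simp add: vimage_def)
  obtain c where c: "0 < c" "\<And>r. 0 < r \<Longrightarrow> c \<le> laplace \<xi> s r"
    using assms(3) s unfolding laplace_bounded_below_def by metis
  have "(\<lambda>k. laplace \<xi> s (real (Suc k))) \<longlonglongrightarrow> (\<integral>\<omega>. indicator ?E \<omega> \<partial>quenched \<xi>)"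
    unfolding laplace_def
  proof (rule integral_dominated_convergence[where w = "\<lambda>_. 1"])
    show "AE \<omega> in quenched \<xi>. (\<lambda>k. mart_lim \<xi> s \<omega> powr real (Suc k)) \<longlonglongrightarrow> indicator ?E \<omega>"
      using AE_mart_lim[OF \<xi> s]
    proof eventually_elim
      case (elim \<omega>)
      let ?x = "mart_lim \<xi> s \<omega>"
      have "?x powr real (Suc k) = ?x ^ Suc k" for k
        using elim by (cases "?x = 0") (simp, intro powr_realpow, auto)
      moreover have "(\<lambda>k. ?x ^ Suc k) \<longlonglongrightarrow> indicator ?E \<omega>"
      proof (cases "?x = 1")
        case False
        then have "(\<lambda>k. ?x ^ Suc k) \<longlonglongrightarrow> 0"
          using elim by (intro LIMSEQ_Suc LIMSEQ_realpow_zero) auto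
        then show ?thesis using False elim by simp
      qed simp
      ultimately show ?case by (simp only:)
    qed
    show "AE \<omega> in quenched \<xi>. norm (mart_lim \<xi> s \<omega> powr real (Suc k)) \<le> 1" for k
      using AE_mart_lim[OF \<xi> s] by eventually_elim (auto intro!: powr_le1)
  qed auto
  then have "c \<le> (\<integral>\<omega>. indicator ?E \<omega> \<partial>quenched \<xi>)"
    by (rule LIMSEQ_le_const) (use c(2) in auto)
  then show ?thesis using c(1) by simp
qed

text \<open>As \<open>r \<rightarrow> 0\<close>, \<open>x powr r\<close> tends to \<open>1\<close>
  for \<open>x > 0\<close> and stays \<open>0\<close> for \<open>x = 0\<close>, so
  \<open>laplace \<xi> s r\<close> tends to the probability of \<open>mart_lim > 0\<close>, which
  the upper bound keeps below \<open>1\<close>.\<close>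

lemma prob_mart_lim_eq_0_pos:
  assumes \<xi>: "\<xi> \<in> no_death" and s: "0 < s" and "laplace_bounded_above \<xi>"
  shows "0 < measure (quenched \<xi>) {\<omega>. mart_lim \<xi> s \<omega> \<le> 0}"
proof -
  interpret prob_space "quenched \<xi>" by (rule prob_space_quenched)
  let ?E = "{\<omega>. mart_lim \<xi> s \<omega> \<le> 0}"
  have [measurable]: "?E \<in> sets (quenched \<xi>)"
    using measurable_sets[OF mart_lim_measurable, of "{..0}" \<xi> s] by (simp add: vimage_def)
  obtain c where c: "c < 1" "\<And>r. 0 < r \<Longrightarrow> laplace \<xi> s r \<le> c"
    using assms(3) s unfolding laplace_bounded_above_def by (metis atLeastLessThan_iff)
  have "(\<lambda>k. laplace \<xi> s (inverse (real (Suc k)))) \<longlonglongrightarrow> (\<integral>\<omega>. 1 - indicator ?E \<omega> \<partial>quenched \<xi>)"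
    unfolding laplace_def
  proof (rule integral_dominated_convergence[where w = "\<lambda>_. 1"])
    show "AE \<omega> in quenched \<xi>. (\<lambda>k. mart_lim \<xi> s \<omega> powr inverse (real (Suc k))) \<longlonglongrightarrow> 1 - indicator ?E \<omega>"
      using AE_mart_lim[OF \<xi> s]
    proof eventually_elim
      case (elim \<omega>)
      show ?case
      proof (cases "mart_lim \<xi> s \<omega> = 0")
        case False
        then have "(\<lambda>k. mart_lim \<xi> s \<omega> powr inverse (real (Suc k))) \<longlonglongrightarrow> mart_lim \<xi> s \<omega> powr 0"
          by (intro tendsto_powr tendsto_const LIMSEQ_inverse_real_of_nat) auto
        then show ?thesis using False elim by (simp add: indicator_def)
      qed simp
    qed
    show "AE \<omega> in quenched \<xi>. norm (mart_lim \<xi> s \<omega> powr inverse (real (Suc k))) \<le> 1" for k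
      using AE_mart_lim[OF \<xi> s] by eventually_elim (auto intro!: powr_le1)
  qed auto
  then have "(\<integral>\<omega>. 1 - indicator ?E \<omega> \<partial>quenched \<xi>) \<le> c"
    by (rule LIMSEQ_le_const2) (use c(2) in auto)
  moreover have "integrable (quenched \<xi>) (indicator ?E :: _ \<Rightarrow> real)"
    by (simp add: integrable_indicator_iff emeasure_eq_measure)
  ultimately show ?thesis
    using c(1) prob_space by simp
qed

subsection \<open>Recurrence of the environment to \<open>D\<close>\<close>

lemma shift_funpow: "(shift ^^ k) \<xi> = (\<lambda>n. \<xi> (n + int k))"
  by (induction k) (auto simp: shift_def algebra_simps)

lemma h_cong: "(\<And>n. \<xi> (int n) = \<zeta> (int n)) \<Longrightarrow> h n \<xi> s = h n \<zeta> s"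
  by (induction n) auto

lemma D_cong:
  assumes "\<And>n. \<xi> (int n) = \<zeta> (int n)"
  shows "\<xi> \<in> D \<longleftrightarrow> \<zeta> \<in> D"
proof -
  have "shift \<xi> (int n) = shift \<zeta> (int n)" for n
    using assms[of "Suc n"] by (simp add: shift_def add.commute)
  then have "d \<xi> s = d \<zeta> s" for s
    unfolding d_def by (intro arg_cong[where f = lim] ext arg_cong2[where f = "(/)"] h_cong assms)
  then show ?thesis by (simp add: D_def)
qed

context
  fixes \<mu> :: "nat pmf measure"
  assumes prob_\<mu>: "prob_space \<mu>" and space_\<mu>: "space \<mu> = UNIV"
begin

lemma prob_space_env_law: "prob_space (env_law \<mu>)"
  unfolding env_law_def by (intro prob_space_PiM prob_\<mu>)

lemma space_env_law: "space (env_law \<mu>) = UNIV"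
  by (simp add: env_law_def space_PiM space_\<mu>)

lemma measurable_env [measurable]: "(\<lambda>\<xi>. \<xi> k) \<in> measurable (env_law \<mu>) \<mu>"
  unfolding env_law_def by measurable

text \<open>Relabelling of i.i.d. coordinates along an injection; it yields both stationarity under
  \<open>shift\<close> and the independence of the coordinates.\<close>

lemma distr_env_reindex:
  assumes "inj f"
  shows "distr (env_law \<mu>) (\<Pi>\<^sub>M i\<in>UNIV. \<mu>) (\<lambda>\<xi> i. \<xi> (f i)) = (\<Pi>\<^sub>M i\<in>UNIV. \<mu>)"
  using distr_PiM_reindex[of UNIV "\<lambda>_. \<mu>" f UNIV] prob_\<mu> assms
  by (simp add: env_law_def restrict_UNIV)

lemma distr_env_component: "distr (env_law \<mu>) \<mu> (\<lambda>\<xi>. \<xi> k) = \<mu>"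
  unfolding env_law_def by (rule distr_PiM_component) (auto intro: prob_\<mu>)

lemma distr_shift: "distr (env_law \<mu>) (env_law \<mu>) shift = env_law \<mu>"
  using distr_env_reindex[of "\<lambda>n. n + 1"] by (simp add: shift_def[abs_def] env_law_def)

lemma measurable_shift [measurable]: "shift \<in> measurable (env_law \<mu>) (env_law \<mu>)"
  unfolding shift_def[abs_def] env_law_def
  by (rule measurable_PiM_single') (auto simp: space_PiM space_\<mu>)

lemma indep_env:
  assumes "inj (f :: 'i \<Rightarrow> int)"
  shows "prob_space.indep_vars (env_law \<mu>) (\<lambda>_. \<mu>) (\<lambda>i \<xi>. \<xi> (f i)) UNIV"
proof -
  interpret prob_space "env_law \<mu>" by (rule prob_space_env_law)
  show ?thesis
    using distr_env_reindex[OF assms]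
    by (subst indep_vars_iff_distr_eq_PiM) (auto simp: distr_env_component restrict_UNIV)
qed

text \<open>A measurable subset of \<open>E\<close> may depend on the past. By Fubini's theorem the past can be frozen
  without losing positivity of the measure.\<close>

lemma positive_future_subset:
  assumes S: "S \<in> sets (env_law \<mu>)" "emeasure (env_law \<mu>) S > 0" "S \<subseteq> E"
    and E: "\<And>\<xi> \<zeta>. (\<And>n. \<xi> (int n) = \<zeta> (int n)) \<Longrightarrow> \<xi> \<in> E \<longleftrightarrow> \<zeta> \<in> E"
  obtains T where "T \<in> sets (\<Pi>\<^sub>M n\<in>(UNIV :: nat set). \<mu>)"
    and "emeasure (env_law \<mu>) {\<xi>. (\<lambda>n. \<xi> (int n)) \<in> T} > 0"
    and "\<And>\<xi>. (\<lambda>n. \<xi> (int n)) \<in> T \<Longrightarrow> \<xi> \<in> E"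
proof -
  interpret prob_space "env_law \<mu>" by (rule prob_space_env_law)
  let ?P = "\<Pi>\<^sub>M n\<in>{..<0::int}. \<mu>" and ?Q = "\<Pi>\<^sub>M n\<in>{0::int..}. \<mu>"
    and ?F = "\<Pi>\<^sub>M n\<in>(UNIV :: nat set). \<mu>"
  \<comment> \<open>\<open>?p\<close> is the past and \<open>?q\<close> the future of an
    environment, \<open>?e\<close> reindexes a sequence over \<open>nat\<close> as a future, and
    \<open>?g\<close> glues a past to a future.\<close>
  let ?p = "\<lambda>\<xi>::environment. restrict \<xi> {..<0}" and ?q = "\<lambda>\<xi>::environment. restrict \<xi> {0..}"
  let ?f = "\<lambda>(\<xi>::environment) (n::nat). \<xi> (int n)"
    and ?e = "\<lambda>t::nat \<Rightarrow> nat pmf. \<lambda>n\<in>{0::int..}. t (nat n)"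
  let ?g = "\<lambda>(x, y) n. if n < 0 then x n else y n"
  have ind: "indep_var ?P ?p ?Q ?q"
    by (rule indep_var_restrict[OF indep_env[of "\<lambda>n. n"]]) auto
  then have rv [measurable]: "?p \<in> measurable (env_law \<mu>) ?P" "?q \<in> measurable (env_law \<mu>) ?Q"
    and joint: "distr (env_law \<mu>) ?P ?p \<Otimes>\<^sub>M distr (env_law \<mu>) ?Q ?q =
      distr (env_law \<mu>) (?P \<Otimes>\<^sub>M ?Q) (\<lambda>\<xi>. (?p \<xi>, ?q \<xi>))"
    by (auto simp: indep_var_distribution_eq)
  have e: "?e \<in> measurable ?F ?Q"
    by (rule measurable_restrict) measurable
  have g [measurable]: "?g \<in> measurable (?P \<Otimes>\<^sub>M ?Q) (env_law \<mu>)"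
    unfolding env_law_def
  proof (rule measurable_PiM_single')
    fix n :: int
    show "(\<lambda>w. ?g w n) \<in> measurable (?P \<Otimes>\<^sub>M ?Q) \<mu>"
      by (cases "n < 0") (auto simp: case_prod_beta)
  qed (auto simp: space_PiM space_\<mu>)
  have gpf: "?g (?p \<xi>, ?q \<xi>) = \<xi>" for \<xi>
    by (auto simp: fun_eq_iff)
  let ?S = "?g -` S \<inter> space (?P \<Otimes>\<^sub>M ?Q)"
  have S': "?S \<in> sets (?P \<Otimes>\<^sub>M ?Q)"
    using measurable_sets[OF g S(1)] .
  interpret q: prob_space "distr (env_law \<mu>) ?Q ?q"
    by (rule prob_space_distr) (rule rv)
  have pre: "(\<lambda>\<xi>. (?p \<xi>, ?q \<xi>)) -` ?S \<inter> space (env_law \<mu>) = S"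
  proof (rule set_eqI)
    fix \<xi>
    have "(?p \<xi>, ?q \<xi>) \<in> space (?P \<Otimes>\<^sub>M ?Q)"
      by (simp add: space_pair_measure space_PiM space_\<mu>)
    then show "\<xi> \<in> (\<lambda>\<xi>. (?p \<xi>, ?q \<xi>)) -` ?S \<inter> space (env_law \<mu>) \<longleftrightarrow> \<xi> \<in> S"
      by (simp only: Int_iff vimage_eq gpf space_env_law UNIV_I simp_thms)
  qed
  \<comment> \<open>By independence the law of past and future is a product, and the mass of
    \<open>S\<close> is the integral over the past \<open>x\<close> of the mass of its section; some
    section must have positive mass.\<close>
  have "emeasure (env_law \<mu>) S = emeasure (distr (env_law \<mu>) (?P \<Otimes>\<^sub>M ?Q) (\<lambda>\<xi>. (?p \<xi>, ?q \<xi>))) ?S"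
    using emeasure_distr[OF measurable_Pair[OF rv] S'] by (simp only: pre)
  also have "\<dots> = (\<integral>\<^sup>+x. emeasure (distr (env_law \<mu>) ?Q ?q) (Pair x -` ?S) \<partial>distr (env_law \<mu>) ?P ?p)"
    unfolding joint[symmetric] by (rule q.emeasure_pair_measure_alt) (use S' in simp)
  finally have "(\<integral>\<^sup>+x. emeasure (distr (env_law \<mu>) ?Q ?q) (Pair x -` ?S) \<partial>distr (env_law \<mu>) ?P ?p) \<noteq> 0"
    using S(2) by simp
  then have "\<not> (\<forall>x. emeasure (distr (env_law \<mu>) ?Q ?q) (Pair x -` ?S) = 0)"
    by (intro notI) simp
  then obtain x where x: "emeasure (distr (env_law \<mu>) ?Q ?q) (Pair x -` ?S) \<noteq> 0"
    by blast
  define T where "T = ?e -` (Pair x -` ?S) \<inter> space ?F"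
  have Sx: "Pair x -` ?S \<in> sets ?Q"
    by (rule sets_Pair1[OF S'])
  have ef: "?e (?f \<xi>) = ?q \<xi>" for \<xi>
    by (auto simp: fun_eq_iff)
  have "emeasure (env_law \<mu>) (?q -` (Pair x -` ?S) \<inter> space (env_law \<mu>)) \<noteq> 0"
    using x emeasure_distr[OF rv(2) Sx] by simp
  moreover have T_iff: "?f \<xi> \<in> T \<longleftrightarrow> ?q \<xi> \<in> Pair x -` ?S" for \<xi>
  proof -
    have "?f \<xi> \<in> space ?F" by (simp add: space_PiM space_\<mu>)
    then show ?thesis unfolding T_def by (simp only: Int_iff vimage_eq ef simp_thms)
  qed
  then have "?q -` (Pair x -` ?S) \<inter> space (env_law \<mu>) = {\<xi>. ?f \<xi> \<in> T}"
    unfolding space_env_law by blast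
  ultimately have "emeasure (env_law \<mu>) {\<xi>. ?f \<xi> \<in> T} > 0"
    by (simp add: zero_less_iff_neq_zero)
  moreover have "\<xi> \<in> E" if "?f \<xi> \<in> T" for \<xi>
  proof -
    have "?g (x, ?q \<xi>) \<in> E"
      using that S(3) unfolding T_iff by blast
    moreover have "\<xi> (int n) = ?g (x, ?q \<xi>) (int n)" for n
      by simp
    ultimately show ?thesis
      using E[of \<xi> "?g (x, ?q \<xi>)"] by blast
  qed
  moreover have "T \<in> sets ?F"
    unfolding T_def by (rule measurable_sets[OF e Sx])
  ultimately show ?thesis
    using that by blast
qed

text \<open>Stationarity gives all \<open>R k\<close> the same probability, so the tail event that
  \<open>T\<close> is visited infinitely often has probability
  \<open>prob (R 0) \<ge> prob (H 0) > 0\<close>. By the zero-one law this probability is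
  \<open>1\<close>.\<close>

lemma AE_shift_recurrent:
  assumes T: "T \<in> sets (\<Pi>\<^sub>M n\<in>(UNIV :: nat set). \<mu>)"
    and pos: "emeasure (env_law \<mu>) {\<xi>. (\<lambda>n. \<xi> (int n)) \<in> T} > 0"
  shows "AE \<xi> in env_law \<mu>. \<exists>k. (\<lambda>n. (shift ^^ k) \<xi> (int n)) \<in> T"
proof -
  interpret prob_space "env_law \<mu>" by (rule prob_space_env_law)
  note sp = space_env_law
  let ?F = "\<Pi>\<^sub>M n\<in>(UNIV :: nat set). \<mu>"
  define A where "A i = sigma_sets UNIV {(\<lambda>\<xi> :: environment. \<xi> (int i)) -` B | B. B \<in> sets \<mu>}" for i
  define H where "H k = {\<xi> :: environment. (\<lambda>n. \<xi> (int n + int k)) \<in> T}" for k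
  define R where "R k = (\<Union>j\<in>{k..}. H j)" for k
  have "indep_vars (\<lambda>_. \<mu>) (\<lambda>i \<xi>. \<xi> (int i)) UNIV"
    by (rule indep_env) (auto simp: inj_def)
  then have ind: "indep_sets A UNIV"
    by (simp add: indep_vars_def A_def[abs_def] sp)
  have HA: "H k \<in> sigma_sets UNIV (\<Union> (A ` {m..}))" if "m \<le> k" for k m
  proof -
    let ?N = "sigma UNIV (\<Union> (A ` {m..}))"
    have sub: "\<Union> (A ` {m..}) \<subseteq> Pow UNIV" by simp
    have "(\<lambda>\<xi> n. \<xi> (int n + int k)) \<in> measurable ?N ?F"
    proof (rule measurable_PiM_single')
      fix n
      show "(\<lambda>\<xi>. \<xi> (int n + int k)) \<in> measurable ?N \<mu>"
      proof (rule measurableI)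
        fix B assume "B \<in> sets \<mu>"
        then have "(\<lambda>\<xi> :: environment. \<xi> (int (n + k))) -` B \<in> A (n + k)"
          unfolding A_def by (intro sigma_sets.Basic) blast
        then have "(\<lambda>\<xi> :: environment. \<xi> (int (n + k))) -` B \<in> \<Union> (A ` {m..})"
          using that by (intro UN_I[of "n + k"]) auto
        then show "(\<lambda>\<xi>. \<xi> (int n + int k)) -` B \<inter> space ?N \<in> sets ?N"
          by auto
      qed (simp add: space_\<mu>)
    qed (auto simp: space_\<mu>)
    from measurable_sets[OF this T] show ?thesis
      by (simp add: H_def vimage_def)
  qed
  have RA: "R k \<in> sigma_sets UNIV (\<Union> (A ` {m..}))" if "m \<le> k" for k m
  proof -
    interpret s: sigma_algebra UNIV "sigma_sets UNIV (\<Union> (A ` {m..}))"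
      by (rule sigma_algebra_sigma_sets) simp
    show ?thesis
      unfolding R_def using HA that by (intro s.countable_UN'') auto
  qed
  have R_mono: "R l \<subseteq> R k" if "k \<le> l" for k l
    using that by (auto simp: R_def intro: order_trans)
  have tail: "(\<Inter>k. R k) \<in> tail_events A"
    unfolding tail_events_def sp
  proof (rule INT_I)
    fix m :: nat
    interpret s: sigma_algebra UNIV "sigma_sets UNIV (\<Union> (A ` {m..}))"
      by (rule sigma_algebra_sigma_sets) simp
    \<comment> \<open>Dropping the first \<open>m\<close> sets leaves the intersection of a
      decreasing family unchanged and removes the dependence on the coordinates before
      \<open>m\<close>.\<close>
    have "(\<Inter>k. R k) = (\<Inter>k\<in>{m..}. R k)"
    proof safe
      fix \<xi> k assume "\<xi> \<in> (\<Inter>k\<in>{m..}. R k)"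
      then have "\<xi> \<in> R (max m k)" by auto
      then show "\<xi> \<in> R k" using R_mono[of k "max m k"] by auto
    qed auto
    also have "\<dots> \<in> sigma_sets UNIV (\<Union> (A ` {m..}))"
      using RA by (intro s.countable_INT'') auto
    finally show "(\<Inter>k. R k) \<in> sigma_sets UNIV (\<Union> (A ` {m..}))" .
  qed
  have events: "R k \<in> events" for k
  proof -
    have "\<Union> (A ` {0..}) \<subseteq> events"
      using ind by (auto simp: indep_sets_def)
    from sets.sigma_sets_subset[OF this] show ?thesis
      using RA[of 0 k] by (auto simp: sp)
  qed
  have "prob (R (Suc k)) = prob (R k)" for k
  proof -
    have "R (Suc k) = shift -` R k \<inter> space (env_law \<mu>)"
    proof -
      have "\<exists>i\<ge>k. j = Suc i" if "Suc k \<le> j" for j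
        using that by (metis Suc_le_D Suc_le_mono)
      then have "{Suc k..} = Suc ` {k..}" by auto
      moreover have "H (Suc j) = shift -` H j" for j
        by (simp add: H_def shift_def vimage_def algebra_simps)
      ultimately show ?thesis
        by (simp add: R_def sp vimage_UN image_image)
    qed
    then show ?thesis
      using measure_distr[OF measurable_shift events[of k]] by (simp add: distr_shift)
  qed
  then have const: "prob (R k) = prob (R 0)" for k
    by (induction k) auto
  have "0 < prob (H 0)"
    using pos by (simp add: H_def emeasure_eq_measure)
  also have "\<dots> \<le> prob (R 0)"
    by (rule finite_measure_mono[OF _ events]) (auto simp: R_def)
  finally have R0: "0 < prob (R 0)" .
  have lim: "(\<lambda>k. prob (R k)) \<longlonglongrightarrow> prob (\<Inter>k. R k)"
  proof (rule finite_Lim_measure_decseq)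
    show "range R \<subseteq> events" using events by blast
    show "decseq R" unfolding decseq_def using R_mono by blast
  qed
  have "(\<lambda>k. prob (R k)) \<longlonglongrightarrow> prob (R 0)"
    by (intro tendsto_eventually always_eventually allI const)
  with lim have "prob (\<Inter>k. R k) = prob (R 0)"
    by (rule LIMSEQ_unique)
  moreover have "prob (\<Inter>k. R k) = 0 \<or> prob (\<Inter>k. R k) = 1"
  proof (rule kolmogorov_0_1_law[OF _ ind tail])
    show "sigma_algebra (space (env_law \<mu>)) (A i)" for i
      unfolding A_def sp by (rule sigma_algebra_sigma_sets) simp
  qed
  ultimately have "prob (R 0) = 1"
    using R0 by auto
  from AE_prob_1[OF this] show ?thesis
    by eventually_elim (auto simp: R_def H_def shift_funpow)
qed

text \<open>\<open>main_part\<close> is a measurable subset of \<open>D\<close> of the same measure,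
  but it may depend on the past; \<open>positive_future_subset\<close> replaces it by a set to which
  the recurrence statement applies.\<close>

lemma AE_shift_in_D:
  assumes "emeasure (completion (env_law \<mu>)) D > 0"
  shows "AE \<xi> in env_law \<mu>. \<exists>k. (shift ^^ k) \<xi> \<in> D"
proof -
  let ?S = "main_part (env_law \<mu>) D"
  \<comment> \<open>\<open>emeasure\<close> vanishes outside the measurable sets, so positivity
    already gives measurability for the completion.\<close>
  have D: "D \<in> sets (completion (env_law \<mu>))"
    using assms by (intro emeasure_neq_0_sets) simp
  have sub: "?S \<subseteq> D"
    using main_part_null_part_Un[OF D] by blast
  have "emeasure (env_law \<mu>) ?S > 0"
    using assms by (simp add: emeasure_completion[OF D])
  from positive_future_subset[OF main_part_sets[OF D] this sub D_cong]
  obtain T where T: "T \<in> sets (\<Pi>\<^sub>M n\<in>(UNIV :: nat set). \<mu>)"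
      "emeasure (env_law \<mu>) {\<xi>. (\<lambda>n. \<xi> (int n)) \<in> T} > 0"
      "\<And>\<xi>. (\<lambda>n. \<xi> (int n)) \<in> T \<Longrightarrow> \<xi> \<in> D"
    by blast
  from AE_shift_recurrent[OF T(1,2)] show ?thesis
    by eventually_elim (use T(3) in blast)
qed

end

subsection \<open>Measurability in the environment\<close>

lemma measurable_pmf [measurable]: "(\<lambda>p. pmf p j) \<in> borel_measurable pmf_algebra"
proof -
  have "(\<lambda>p. emeasure (measure_pmf p) {j}) \<in> borel_measurable pmf_algebra"
    by (rule measurable_compose[OF measurable_measure_pmf_algebra measurable_emeasure_subprob_algebra]) simp
  then have "(\<lambda>p. enn2real (emeasure (measure_pmf p) {j})) \<in> borel_measurable pmf_algebra"
    by measurable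
  then show ?thesis
    by (simp add: emeasure_pmf_single)
qed

lemma measurable_pgf [measurable]: "(\<lambda>p. pgf p a) \<in> borel_measurable pmf_algebra"
  unfolding pgf_def by measurable

lemma pgf_inv_le_iff:
  assumes "pmf p 0 = 0" "y \<in> {0..1}" "a \<in> {0..1}"
  shows "pgf_inv p y \<le> a \<longleftrightarrow> y \<le> pgf p a"
  using pgf_le_cancel[of p "pgf_inv p y" a] pgf_inv[of p y] assms by auto

text \<open>Through \<open>pgf_inv_le_iff\<close>, the sublevel sets of the inverse are described by
  \<open>pgf\<close> at the fixed point \<open>a\<close>, so it is enough that
  \<open>pgf _ a\<close> is measurable in the distribution.\<close>

lemma measurable_h1:
  assumes P [measurable]: "P \<in> measurable M pmf_algebra" and f [measurable]: "f \<in> borel_measurable M"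
    and good: "\<And>x. x \<in> space M \<Longrightarrow> pmf (P x) 0 = 0 \<and> 0 < f x"
  shows "(\<lambda>x. h1 (P x) (f x)) \<in> borel_measurable M"
proof -
  have "(\<lambda>x. pgf_inv (P x) (exp (- f x))) \<in> borel_measurable M"
    unfolding borel_measurable_iff_le
  proof
    fix a :: real
    have y: "exp (- f x) \<in> {0..1}" if "x \<in> space M" for x
      using good[OF that] by simp
    have in01: "pgf_inv (P x) (exp (- f x)) \<in> {0..1}" if "x \<in> space M" for x
      using pgf_inv_in[of "P x" "exp (- f x)"] y[OF that] good[OF that] by auto
    consider "a < 0" | "1 < a" | "a \<in> {0..1}" by force
    then show "{x \<in> space M. pgf_inv (P x) (exp (- f x)) \<le> a} \<in> sets M"
    proof cases
      case 1
      then have "{x \<in> space M. pgf_inv (P x) (exp (- f x)) \<le> a} = {}"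
        using in01 by fastforce
      then show ?thesis by (simp only: sets.empty_sets)
    next
      case 2
      then have "{x \<in> space M. pgf_inv (P x) (exp (- f x)) \<le> a} = space M"
        using in01 by force
      then show ?thesis by simp
    next
      case 3
      then have "{x \<in> space M. pgf_inv (P x) (exp (- f x)) \<le> a} =
          {x \<in> space M. exp (- f x) \<le> pgf (P x) a}"
        using y good by (auto simp: pgf_inv_le_iff)
      also have "\<dots> \<in> sets M" by measurable
      finally show ?thesis .
    qed
  qed
  then show ?thesis
    unfolding h1_def by measurable
qed

context
  fixes \<mu> :: "nat pmf measure"
  assumes prob_\<mu>: "prob_space \<mu>" and sets_\<mu>: "sets \<mu> = sets pmf_algebra"
begin

lemma space_eq_UNIV: "space \<mu> = UNIV"
  using sets_eq_imp_space_eq[OF sets_\<mu>] by simp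

lemma measurable_env_pmf [measurable]: "(\<lambda>\<xi>. \<xi> k) \<in> measurable (env_law \<mu>) pmf_algebra"
  using measurable_env[OF prob_\<mu> space_eq_UNIV, of k] sets_\<mu> by (simp cong: measurable_cong_sets)

lemma sets_no_death: "no_death \<in> sets (env_law \<mu>)"
proof -
  have "no_death = {\<xi> \<in> space (env_law \<mu>). \<forall>n. pmf (\<xi> (int n)) 0 = 0}"
    by (simp add: no_death_def space_env_law[OF prob_\<mu> space_eq_UNIV])
  also have "\<dots> \<in> sets (env_law \<mu>)" by measurable
  finally show ?thesis .
qed

lemma measurable_h_no_death:
  assumes s: "0 < s"
  shows "(\<lambda>\<xi>. h n \<xi> s) \<in> borel_measurable (restrict_space (env_law \<mu>) no_death)"
proof (induction n)
  case (Suc n)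
  have "(\<lambda>\<xi>. \<xi> (int n)) \<in> measurable (restrict_space (env_law \<mu>) no_death) pmf_algebra"
    by (rule measurable_restrict_space1) measurable
  from measurable_h1[OF this Suc] show ?case
    using s by (auto simp: space_restrict_space no_deathD h_pos)
qed simp

text \<open>Off \<open>no_death\<close> the inverse in \<open>h1\<close> is not controlled, so
  \<open>h\<close> is replaced by \<open>0\<close> there to obtain a measurable function on the
  whole space.\<close>

lemma measurable_h_cut:
  assumes "0 < s"
  shows "(\<lambda>\<xi>. if \<xi> \<in> no_death then h n \<xi> s else 0) \<in> borel_measurable (env_law \<mu>)"
  using measurable_h_no_death[OF assms] sets_no_death
  by (subst (asm) measurable_restrict_space_iff[where c = 0]) auto

lemma measurable_mart_lim:
  assumes s: "0 < s"
  shows "(\<lambda>(\<xi>, \<omega>). if \<xi> \<in> no_death then mart_lim \<xi> s \<omega> else 1)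
    \<in> borel_measurable (env_law \<mu> \<Otimes>\<^sub>M offspring_space)"
proof -
  let ?H = "\<lambda>n \<xi>. if \<xi> \<in> no_death then h n \<xi> s else 0"
  note measurable_h_cut[OF s, measurable]
  have "(\<lambda>w. lim (\<lambda>n. exp (- ?H n (fst w)) ^ Z n (snd w))) \<in> borel_measurable (env_law \<mu> \<Otimes>\<^sub>M offspring_space)"
    by measurable
  \<comment> \<open>Off \<open>no_death\<close> the cut makes every term
    \<open>exp 0 ^ Z n = 1\<close>; this is the source of the default value
    \<open>1\<close>.\<close>
  also have "(\<lambda>w. lim (\<lambda>n. exp (- ?H n (fst w)) ^ Z n (snd w))) =
      (\<lambda>(\<xi>, \<omega>). if \<xi> \<in> no_death then mart_lim \<xi> s \<omega> else 1)"
    by (auto simp: fun_eq_iff mart_lim_def)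
  finally show ?thesis .
qed

text \<open>The hypothesis at time \<open>0\<close> is a statement about \<open>\<mu>\<close>, which
  is the law of every coordinate; countably many null sets are then united.\<close>

lemma AE_no_death:
  assumes "measure (env_law \<mu>) {\<xi> \<in> space (env_law \<mu>). pmf (\<xi> 0) 0 = 0} = 1"
  shows "AE \<xi> in env_law \<mu>. \<xi> \<in> no_death"
proof -
  interpret prob_space "env_law \<mu>"
    by (rule prob_space_env_law[OF prob_\<mu> space_eq_UNIV])
  note comp = distr_env_component[OF prob_\<mu> space_eq_UNIV]
  have [measurable]: "Measurable.pred \<mu> (\<lambda>p. pmf p 0 = 0)"
    by (simp add: measurable_cong_sets[OF sets_\<mu> refl])
  have "AE \<xi> in env_law \<mu>. pmf (\<xi> 0) 0 = 0"
    using AE_prob_1[OF assms] by auto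
  then have "AE p in distr (env_law \<mu>) \<mu> (\<lambda>\<xi>. \<xi> 0). pmf p 0 = 0"
    using measurable_env[OF prob_\<mu> space_eq_UNIV] by (subst AE_distr_iff) auto
  then have \<mu>: "AE p in \<mu>. pmf p 0 = 0"
    unfolding comp .
  have "AE \<xi> in env_law \<mu>. pmf (\<xi> (int n)) 0 = 0" for n
    unfolding env_law_def by (rule AE_PiM_component[of UNIV "\<lambda>_. \<mu>"]) (auto intro: prob_\<mu> \<mu>)
  then show ?thesis
    by (simp add: no_death_def AE_all_countable)
qed

lemma sets_annealed: "sets (annealed \<mu>) = sets (env_law \<mu> \<Otimes>\<^sub>M offspring_space)"
  unfolding annealed_def
proof (rule sets_bind)
  show "sets (distr (quenched \<xi>) (env_law \<mu> \<Otimes>\<^sub>M offspring_space) (Pair \<xi>)) =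
    sets (env_law \<mu> \<Otimes>\<^sub>M offspring_space)" for \<xi> by simp
qed (simp add: space_env_law[OF prob_\<mu> space_eq_UNIV])

lemma AE_annealedI:
  assumes A: "{w \<in> space (env_law \<mu> \<Otimes>\<^sub>M offspring_space). P w} \<in> sets (env_law \<mu> \<Otimes>\<^sub>M offspring_space)"
    and ae: "AE \<xi> in env_law \<mu>. AE \<omega> in quenched \<xi>. P (\<xi>, \<omega>)"
  shows "AE w in annealed \<mu>. P w"
proof (rule AE_I)
  let ?M = "env_law \<mu> \<Otimes>\<^sub>M offspring_space"
  let ?N = "space ?M - {w \<in> space ?M. P w}"
  have sp: "space ?M = UNIV"
    by (simp add: space_pair_measure space_env_law[OF prob_\<mu> space_eq_UNIV])
  have N: "?N \<in> sets ?M"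
    using A by auto
  then show "?N \<in> sets (annealed \<mu>)"
    by (simp add: sets_annealed)
  have "emeasure (annealed \<mu>) ?N = (\<integral>\<^sup>+\<xi>. emeasure (quenched \<xi>) {\<omega>. (\<xi>, \<omega>) \<in> ?N} \<partial>env_law \<mu>)"
    by (rule emeasure_annealed[OF sets_\<mu> N])
  also have "\<dots> = (\<integral>\<^sup>+\<xi>. 0 \<partial>env_law \<mu>)"
  proof (rule nn_integral_cong_AE, use ae in eventually_elim)
    case (elim \<xi>)
    then have "emeasure (quenched \<xi>) {\<omega> \<in> space (quenched \<xi>). \<not> P (\<xi>, \<omega>)} = 0"
      by (intro emeasure_eq_0_AE) auto
    then show ?case by (simp add: sp)
  qed
  finally show "emeasure (annealed \<mu>) ?N = 0" by simp
  show "{w \<in> space (annealed \<mu>). \<not> P w} \<subseteq> ?N"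
    by (auto simp: sp)
qed

end

section \<open>The logarithm with values in the extended half-line, and the theorem\<close>

text \<open>For \<open>x > 1\<close> the value is \<open>0\<close>, since \<open>ennreal\<close> cuts off negative numbers.\<close>

definition neg_ln :: "real \<Rightarrow> ennreal" where
  "neg_ln x = (if x \<le> 0 then \<infinity> else ennreal (- ln x))"

lemma measurable_neg_ln [measurable]: "neg_ln \<in> borel_measurable borel"
  unfolding neg_ln_def[abs_def] by measurable

lemma neg_ln_eq_top_iff: "neg_ln x = top \<longleftrightarrow> x \<le> 0"
  by (simp add: neg_ln_def)

lemma neg_ln_eq_0_iff: "neg_ln x = 0 \<longleftrightarrow> 1 \<le> x"
  by (auto simp: neg_ln_def ennreal_eq_0_iff ln_ge_zero_iff)

lemma tendsto_neg_ln:
  assumes "(\<lambda>n. exp (- a n)) \<longlonglongrightarrow> x" "0 \<le> x"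
  shows "(\<lambda>n. ennreal (a n)) \<longlonglongrightarrow> neg_ln x"
proof (cases "x = 0")
  case True
  have "filterlim (\<lambda>n. exp (- a n)) (at_right 0) sequentially"
    using assms True by (auto simp: filterlim_at)
  then have "filterlim (\<lambda>n. ln (exp (- a n))) at_bot sequentially"
    by (rule filterlim_compose[OF ln_at_0])
  then have "filterlim a at_top sequentially"
    by (simp add: filterlim_uminus_at_bot)
  then show ?thesis
    using True by (simp add: neg_ln_def ennreal_tendsto_top_eq_at_top)
next
  case False
  then have "(\<lambda>n. - ln (exp (- a n))) \<longlonglongrightarrow> - ln x"
    using assms by (intro tendsto_intros) auto
  then show ?thesis
    using False assms(2) by (simp add: neg_ln_def tendsto_ennrealI)
qed

text \<open>Expresses convergence by two inequalities between measurable functions, so that the set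
  of convergence is measurable even when the limit varies with the point.\<close>

lemma tendsto_iff_limsup_le_liminf:
  fixes f :: "nat \<Rightarrow> 'a :: {complete_linorder, linorder_topology}"
  shows "f \<longlonglongrightarrow> l \<longleftrightarrow> limsup f \<le> l \<and> l \<le> liminf f"
  using Liminf_le_Limsup[of sequentially f]
  by (auto simp: tendsto_iff_Liminf_eq_Limsup)

theorem theorem2p3:
  fixes \<mu> :: "nat pmf measure"
  assumes "prob_space \<mu>" and "sets \<mu> = sets pmf_algebra"
    and "measure (env_law \<mu>) {\<xi> \<in> space (env_law \<mu>). pmf (\<xi> 0) 0 = 0} = 1"
  shows "\<forall>s>0. \<exists>W :: environment \<times> offspring \<Rightarrow> ennreal.
    W \<in> borel_measurable (env_law \<mu> \<Otimes>\<^sub>M offspring_space) \<and>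
    (AE (\<xi>, \<omega>) in annealed \<mu>. (\<lambda>n. ennreal (real (Z n \<omega>) * h n \<xi> s)) \<longlonglongrightarrow> W (\<xi>, \<omega>)) \<and>
    (emeasure (completion (env_law \<mu>)) D > 0 \<longrightarrow>
      (AE \<xi> in env_law \<mu>.
        measure (quenched \<xi>) {\<omega> \<in> space (quenched \<xi>). W (\<xi>, \<omega>) = \<infinity>} > 0 \<and>
        measure (quenched \<xi>) {\<omega> \<in> space (quenched \<xi>). W (\<xi>, \<omega>) = 0} > 0))"
proof (intro allI impI)
  fix s :: real assume s: "0 < s"
  let ?M = "env_law \<mu> \<Otimes>\<^sub>M offspring_space"
  \<comment> \<open>The value \<open>1\<close> off \<open>no_death\<close>, a null set of
    environments, keeps \<open>X\<close> jointly measurable; there \<open>W = 0\<close>.\<close>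
  define X where "X = (\<lambda>(\<xi>, \<omega>). if \<xi> \<in> no_death then mart_lim \<xi> s \<omega> else 1)"
  define W where "W w = neg_ln (X w)" for w
  have X [measurable]: "X \<in> borel_measurable ?M"
    unfolding X_def by (rule measurable_mart_lim[OF assms(1,2) s])
  have W [measurable]: "W \<in> borel_measurable ?M"
    unfolding W_def[abs_def] by measurable
  have nd: "AE \<xi> in env_law \<mu>. \<xi> \<in> no_death"
    by (rule AE_no_death[OF assms])
  have conv: "AE \<omega> in quenched \<xi>. (\<lambda>n. ennreal (real (Z n \<omega>) * h n \<xi> s)) \<longlonglongrightarrow> W (\<xi>, \<omega>)"
    if \<xi>: "\<xi> \<in> no_death" for \<xi>
    using AE_mart_lim[OF \<xi> s]
  proof eventually_elim
    case (elim \<omega>)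
    then have "(\<lambda>n. exp (- (real (Z n \<omega>) * h n \<xi> s))) \<longlonglongrightarrow> mart_lim \<xi> s \<omega>"
      by (simp flip: exp_of_nat_mult)
    from tendsto_neg_ln[OF this] elim show ?case
      using \<xi> by (simp add: W_def X_def)
  qed
  \<comment> \<open>\<open>H\<close> stands in for \<open>h\<close> to make the set of convergence
    measurable; the conjunct \<open>fst w \<in> no_death\<close> below lets \<open>h\<close> return
    afterwards.\<close>
  define H where "H n \<xi> = (if \<xi> \<in> no_death then h n \<xi> s else 0)" for n \<xi>
  have [measurable]: "H n \<in> borel_measurable (env_law \<mu>)" for n
    unfolding H_def[abs_def] by (rule measurable_h_cut[OF assms(1,2) s])
  have [measurable]: "no_death \<in> sets (env_law \<mu>)"
    by (rule sets_no_death[OF assms(1,2)])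
  have "AE w in annealed \<mu>. fst w \<in> no_death \<and>
    (\<lambda>n. ennreal (real (Z n (snd w)) * H n (fst w))) \<longlonglongrightarrow> W w"
  proof (rule AE_annealedI[OF assms(1,2)])
    show "{w \<in> space ?M. fst w \<in> no_death \<and>
        (\<lambda>n. ennreal (real (Z n (snd w)) * H n (fst w))) \<longlonglongrightarrow> W w} \<in> sets ?M"
      unfolding tendsto_iff_limsup_le_liminf by measurable
    show "AE \<xi> in env_law \<mu>. AE \<omega> in quenched \<xi>. fst (\<xi>, \<omega>) \<in> no_death \<and>
        (\<lambda>n. ennreal (real (Z n (snd (\<xi>, \<omega>))) * H n (fst (\<xi>, \<omega>)))) \<longlonglongrightarrow> W (\<xi>, \<omega>)"
      using nd by eventually_elim (use conv in \<open>simp add: H_def\<close>)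
  qed
  then have "AE (\<xi>, \<omega>) in annealed \<mu>. (\<lambda>n. ennreal (real (Z n \<omega>) * h n \<xi> s)) \<longlonglongrightarrow> W (\<xi>, \<omega>)"
    by eventually_elim (auto simp: H_def)
  moreover have "AE \<xi> in env_law \<mu>.
        measure (quenched \<xi>) {\<omega> \<in> space (quenched \<xi>). W (\<xi>, \<omega>) = \<infinity>} > 0 \<and>
        measure (quenched \<xi>) {\<omega> \<in> space (quenched \<xi>). W (\<xi>, \<omega>) = 0} > 0"
    if "emeasure (completion (env_law \<mu>)) D > 0"
    using nd AE_shift_in_D[OF assms(1) space_eq_UNIV[OF assms(1,2)] that]
  proof eventually_elim
    case (elim \<xi>)
    then have "laplace_bounded_below \<xi>" "laplace_bounded_above \<xi>"
      using laplace_bounded_funpow_shift by blast+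
    then show ?case
      using prob_mart_lim_eq_1_pos[of \<xi> s] prob_mart_lim_eq_0_pos[of \<xi> s] elim(1) s
      by (simp add: W_def X_def neg_ln_eq_0_iff neg_ln_eq_top_iff)
  qed
  ultimately show "\<exists>W :: environment \<times> offspring \<Rightarrow> ennreal.
    W \<in> borel_measurable ?M \<and>
    (AE (\<xi>, \<omega>) in annealed \<mu>. (\<lambda>n. ennreal (real (Z n \<omega>) * h n \<xi> s)) \<longlonglongrightarrow> W (\<xi>, \<omega>)) \<and>
    (emeasure (completion (env_law \<mu>)) D > 0 \<longrightarrow>
      (AE \<xi> in env_law \<mu>.
        measure (quenched \<xi>) {\<omega> \<in> space (quenched \<xi>). W (\<xi>, \<omega>) = \<infinity>} > 0 \<and>
        measure (quenched \<xi>) {\<omega> \<in> space (quenched \<xi>). W (\<xi>, \<omega>) = 0} > 0))"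
    using W by blast
qed

end
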